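(* Let $G$ and $H$ be graphs. Then the functor $\Phi:\Pi(G\times H)\to\Pi(G)\times_{\mathbb{Z}/2}\Pi(H)$ induced by the projections $G\times H\to G$ and $G\times H\to H$ is an isomorphism of groupoids.
   Context: A graph $G$ is undirected without multiple edges, loops allowed: a vertex set $V(G)$ with a symmetric adjacency relation $\sim$ (edges). A graph morphism $f: G\to H$ is a map $V(G)\to V(H)$ with $v_1\sim v_2 \Rightarrow f(v_1)\sim f(v_2)$. The product $G\times H$ has vertices $V(G)\times V(H)$, with $(v_1,w_1)\sim(v_2,w_2)$ iff $v_1\sim v_2$ and $w_1\sim w_2$. $P_n$ is the graph on $\{0,\dots,n\}$ whose edges are $i\sim i+1$; $I_n^\ell$ is the graph on $\{0,\dots,n\}$ whose edges are $i\sim i$ and $i\sim i+1$. A walk of length $n\ge0$ in $G$ from $v_0$ to $v_n$ is a morphism $P_n\to G$, written $(v_0v_1\dots v_n)$. Concatenation of $(x v_1\dots v_{n-1}y)$ with $(y w_1\dots w_{m-1}z)$ is $(x v_1\dots v_{n-1}y w_1\dots w_{m-1}z)$. If $v_i=v_{i+2}$ in a walk, the prune at $i$ is the walk obtained by deleting the entries $v_i,v_{i+1}$. Two walks $\alpha,\beta$ of length $n$ from $x$ to $y$ are homotopic rel endpoints if there are $m\ge 0$ and a morphism $\Lambda:P_n\times I_m^\ell\to G$ with $\Lambda(\cdot,0)=\alpha$, $\Lambda(\cdot,m)=\beta$, and $\Lambda(0,j)=x$, $\Lambda(n,j)=y$ for all $j$. The fundamental groupoid $\Pi(G)$ has as objects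 the vertices of $G$; arrows from $v$ to $w$ are equivalence classes of walks from $v$ to $w$ under the equivalence relation generated by prunes and homotopy rel endpoints; composition is induced by concatenation. A graph morphism $\phi$ induces a functor $\phi_*$ by applying $\phi$ to each vertex of a walk. The parity of the length of a walk is constant on equivalence classes, giving a functor $\Pi(G)\to\mathbb{Z}/2$ (the group $\mathbb{Z}/2$ viewed as a one-object groupoid; this is also the functor induced by the unique morphism from $G$ to the graph $T$ with one looped vertex, for which $\Pi(T)\cong\mathbb{Z}/2$). The pullback groupoid $\Pi(G)\times_{\mathbb{Z}/2}\Pi(H)$ has as objects pairs $(v,w)\in V(G)\times V(H)$ and as arrows pairs $(\alpha,\beta)$ of an arrow $\alpha$ of $\Pi(G)$ and an arrow $\beta$ of $\Pi(H)$ of the same parity, with componentwise composition. The functor $\Phi$ is the identity on objects and sends an arrow $\omega$ to the pair of its images under the functors induced by the two projections.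
   Formalization: Assumes in addition that neither G nor H has an isolated vertex (a looped vertex is not isolated); without this the claim fails, e.g. G a single vertex without edges and H = P_2, where (id, (0 1 2)) has no preimage. *)

theory Defs
  imports "Graph_Theory.Pair_Digraph" "HOL-Library.Z2"
begin

section \<open>Graphs\<close>

text \<open>An undirected graph without multiple edges, loops allowed and possibly infinite, is a
  \<^term>\<open>G :: 'a pair_pre_digraph\<close> with \<^term>\<open>pair_sym_digraph G\<close>; adjacency of \<open>v\<close> and \<open>w\<close> is
  \<^term>\<open>(v, w) \<in> parcs G\<close>.\<close>

definition graph_hom ::
  "'a pair_pre_digraph \<Rightarrow> 'b pair_pre_digraph \<Rightarrow> ('a \<Rightarrow> 'b) \<Rightarrow> bool" where
  "graph_hom G H f \<longleftrightarrow>
     (\<forall>v \<in> pverts G. f v \<in> pverts H) \<and> (\<forall>v w. (v, w) \<in> parcs G \<longrightarrow> (f v, f w) \<in> parcs H)"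

definition graph_prod ::
  "'a pair_pre_digraph \<Rightarrow> 'b pair_pre_digraph \<Rightarrow> ('a \<times> 'b) pair_pre_digraph"
  (infixr \<open>\<times>\<^sub>g\<close> 80) where
  "G \<times>\<^sub>g H = \<lparr> pverts = pverts G \<times> pverts H,
     parcs = {((v1, w1), (v2, w2)) | v1 w1 v2 w2. (v1, v2) \<in> parcs G \<and> (w1, w2) \<in> parcs H} \<rparr>"

definition path_graph :: "nat \<Rightarrow> nat pair_pre_digraph" where
  "path_graph n = \<lparr> pverts = {0..n},
     parcs = {(i, j). i \<le> n \<and> j \<le> n \<and> (j = i + 1 \<or> i = j + 1)} \<rparr>"

definition looped_path_graph :: "nat \<Rightarrow> nat pair_pre_digraph" where
  "looped_path_graph n = \<lparr> pverts = {0..n},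
     parcs = {(i, j). i \<le> n \<and> j \<le> n \<and> (j = i \<or> j = i + 1 \<or> i = j + 1)} \<rparr>"

text \<open>A vertex carrying a loop is not isolated. If \<open>v\<close> is isolated in \<open>G\<close>, every vertex \<open>(v, w)\<close> of
  the product is isolated, so \<open>v\<close> paired with a nontrivial even walk in \<open>H\<close> does not lift.\<close>

definition no_isolated_vertices :: "'a pair_pre_digraph \<Rightarrow> bool" where
  "no_isolated_vertices G \<longleftrightarrow> (\<forall>v \<in> pverts G. \<exists>w. (v, w) \<in> parcs G)"


section \<open>Walks\<close>

text \<open>The walk \<open>(v\<^sub>0 v\<^sub>1 \<dots> v\<^sub>n)\<close> is the list of its \<open>n + 1\<close> entries.\<close>

abbreviation walk_length :: "'a list \<Rightarrow> nat" where
  "walk_length \<alpha> \<equiv> length \<alpha> - 1"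

definition is_walk :: "'a pair_pre_digraph \<Rightarrow> 'a list \<Rightarrow> bool" where
  "is_walk G \<alpha> \<longleftrightarrow> \<alpha> \<noteq> [] \<and> graph_hom (path_graph (walk_length \<alpha>)) G (\<lambda>i. \<alpha> ! i)"

definition walks :: "'a pair_pre_digraph \<Rightarrow> 'a \<Rightarrow> 'a \<Rightarrow> 'a list set" where
  "walks G x y = {\<alpha>. is_walk G \<alpha> \<and> hd \<alpha> = x \<and> last \<alpha> = y}"

text \<open>Meant for \<^prop>\<open>last \<alpha> = hd \<beta>\<close>; the repeated vertex is written once.\<close>

definition walk_concat :: "'a list \<Rightarrow> 'a list \<Rightarrow> 'a list" where
  "walk_concat \<alpha> \<beta> = \<alpha> @ tl \<beta>"

definition prunes_to :: "'a list \<Rightarrow> 'a list \<Rightarrow> bool" where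
  "prunes_to \<alpha> \<beta> \<longleftrightarrow>
     (\<exists>i. i + 2 < length \<alpha> \<and> \<alpha> ! i = \<alpha> ! (i + 2) \<and> \<beta> = take i \<alpha> @ drop (i + 2) \<alpha>)"

definition homotopic_rel_endpoints :: "'a pair_pre_digraph \<Rightarrow> 'a list \<Rightarrow> 'a list \<Rightarrow> bool" where
  "homotopic_rel_endpoints G \<alpha> \<beta> \<longleftrightarrow>
     length \<alpha> = length \<beta> \<and>
     (\<exists>m \<Lambda>. graph_hom (path_graph (walk_length \<alpha>) \<times>\<^sub>g looped_path_graph m) G \<Lambda> \<and>
        (\<forall>i \<le> walk_length \<alpha>. \<Lambda> (i, 0) = \<alpha> ! i \<and> \<Lambda> (i, m) = \<beta> ! i) \<and>
        (\<forall>j \<le> m. \<Lambda> (0, j) = hd \<alpha> \<and> \<Lambda> (walk_length \<alpha>, j) = last \<alpha>))"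

definition walk_step :: "'a pair_pre_digraph \<Rightarrow> 'a list \<Rightarrow> 'a list \<Rightarrow> bool" where
  "walk_step G \<alpha> \<beta> \<longleftrightarrow>
     is_walk G \<alpha> \<and> is_walk G \<beta> \<and> (prunes_to \<alpha> \<beta> \<or> homotopic_rel_endpoints G \<alpha> \<beta>)"

text \<open>Prunes and homotopies rel endpoints preserve the endpoints and relate walks only to walks,
  so the class of a walk from \<open>x\<close> to \<open>y\<close> consists of walks from \<open>x\<close> to \<open>y\<close>.\<close>

definition walk_class :: "'a pair_pre_digraph \<Rightarrow> 'a list \<Rightarrow> 'a list set" where
  "walk_class G \<alpha> = {\<beta>. equivclp (walk_step G) \<alpha> \<beta>}"


section \<open>Groupoids and functors\<close>

text \<open>\<^term>\<open>Comp C f g\<close> is in diagrammatic order: first \<open>f\<close>, then \<open>g\<close>.\<close>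

record ('o, 'a) cat =
  Ob :: "'o set"
  Hom :: "'o \<Rightarrow> 'o \<Rightarrow> 'a set"
  Ident :: "'o \<Rightarrow> 'a"
  Comp :: "'a \<Rightarrow> 'a \<Rightarrow> 'a"

locale category =
  fixes C :: "('o, 'a) cat"
  assumes Hom_disjoint: "\<lbrakk> x \<in> Ob C; y \<in> Ob C; x' \<in> Ob C; y' \<in> Ob C;
      f \<in> Hom C x y; f \<in> Hom C x' y' \<rbrakk> \<Longrightarrow> x = x' \<and> y = y'"
    and Ident_in_Hom: "x \<in> Ob C \<Longrightarrow> Ident C x \<in> Hom C x x"
    and Comp_in_Hom: "\<lbrakk> x \<in> Ob C; y \<in> Ob C; z \<in> Ob C; f \<in> Hom C x y; g \<in> Hom C y z \<rbrakk>
      \<Longrightarrow> Comp C f g \<in> Hom C x z"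
    and Comp_Ident_left: "\<lbrakk> x \<in> Ob C; y \<in> Ob C; f \<in> Hom C x y \<rbrakk> \<Longrightarrow> Comp C (Ident C x) f = f"
    and Comp_Ident_right: "\<lbrakk> x \<in> Ob C; y \<in> Ob C; f \<in> Hom C x y \<rbrakk> \<Longrightarrow> Comp C f (Ident C y) = f"
    and Comp_assoc: "\<lbrakk> w \<in> Ob C; x \<in> Ob C; y \<in> Ob C; z \<in> Ob C;
      f \<in> Hom C w x; g \<in> Hom C x y; h \<in> Hom C y z \<rbrakk>
      \<Longrightarrow> Comp C (Comp C f g) h = Comp C f (Comp C g h)"

locale groupoid = category +
  assumes inverse_exists: "\<lbrakk> x \<in> Ob C; y \<in> Ob C; f \<in> Hom C x y \<rbrakk>
    \<Longrightarrow> \<exists>g \<in> Hom C y x. Comp C f g = Ident C x \<and> Comp C g f = Ident C y"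

record ('o, 'a, 'p, 'b) funct =
  omap :: "'o \<Rightarrow> 'p"
  amap :: "'a \<Rightarrow> 'b"

locale is_functor = source: category C + target: category D
  for C :: "('o, 'a) cat" and D :: "('p, 'b) cat" +
  fixes F :: "('o, 'a, 'p, 'b) funct"
  assumes omap_in_Ob: "x \<in> Ob C \<Longrightarrow> omap F x \<in> Ob D"
    and amap_in_Hom: "\<lbrakk> x \<in> Ob C; y \<in> Ob C; f \<in> Hom C x y \<rbrakk>
      \<Longrightarrow> amap F f \<in> Hom D (omap F x) (omap F y)"
    and amap_Ident: "x \<in> Ob C \<Longrightarrow> amap F (Ident C x) = Ident D (omap F x)"
    and amap_Comp: "\<lbrakk> x \<in> Ob C; y \<in> Ob C; z \<in> Ob C; f \<in> Hom C x y; g \<in> Hom C y z \<rbrakk>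
      \<Longrightarrow> amap F (Comp C f g) = Comp D (amap F f) (amap F g)"

text \<open>\<open>K\<close> composed after \<open>F\<close> is the identity functor of \<open>C\<close>.\<close>

definition left_inverse_functor ::
  "('o, 'a) cat \<Rightarrow> ('o, 'a, 'p, 'b) funct \<Rightarrow> ('p, 'b, 'o, 'a) funct \<Rightarrow> bool" where
  "left_inverse_functor C F K \<longleftrightarrow>
     (\<forall>x \<in> Ob C. omap K (omap F x) = x) \<and>
     (\<forall>x \<in> Ob C. \<forall>y \<in> Ob C. \<forall>f \<in> Hom C x y. amap K (amap F f) = f)"

definition groupoid_isomorphism ::
  "('o, 'a) cat \<Rightarrow> ('p, 'b) cat \<Rightarrow> ('o, 'a, 'p, 'b) funct \<Rightarrow> bool" where
  "groupoid_isomorphism C D F \<longleftrightarrow>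
     groupoid C \<and> groupoid D \<and> is_functor C D F \<and>
     (\<exists>K. is_functor D C K \<and> left_inverse_functor C F K \<and> left_inverse_functor D K F)"

definition pullback ::
  "('o, 'a) cat \<Rightarrow> ('o, 'a, 'q, 'c) funct \<Rightarrow> ('p, 'b) cat \<Rightarrow> ('p, 'b, 'q, 'c) funct \<Rightarrow>
   ('o \<times> 'p, 'a \<times> 'b) cat" where
  "pullback C F D K = \<lparr>
     Ob = {(x, y). x \<in> Ob C \<and> y \<in> Ob D \<and> omap F x = omap K y},
     Hom = (\<lambda>(x, y) (x', y'). {(f, g). f \<in> Hom C x x' \<and> g \<in> Hom D y y' \<and> amap F f = amap K g}),
     Ident = (\<lambda>(x, y). (Ident C x, Ident D y)),
     Comp = (\<lambda>(f, g) (f', g'). (Comp C f f', Comp D g g')) \<rparr>"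

definition Z2_groupoid :: "(unit, bit) cat" where
  "Z2_groupoid = \<lparr> Ob = {()}, Hom = (\<lambda>_ _. UNIV), Ident = (\<lambda>_. 0), Comp = (+) \<rparr>"


section \<open>The fundamental groupoid\<close>

text \<open>Operations on arrows are defined by applying the operation on walks to all representatives
  and collecting the resulting classes; since the operations respect the equivalence relation,
  only one class arises.\<close>

definition fund_groupoid :: "'a pair_pre_digraph \<Rightarrow> ('a, 'a list set) cat" (\<open>\<Pi>\<^sub>g\<close>) where
  "\<Pi>\<^sub>g G = \<lparr>
     Ob = pverts G,
     Hom = (\<lambda>x y. walk_class G ` walks G x y),
     Ident = (\<lambda>x. walk_class G [x]),
     Comp = (\<lambda>A B. \<Union>\<alpha> \<in> A. \<Union>\<beta> \<in> B. walk_class G (walk_concat \<alpha> \<beta>)) \<rparr>"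

text \<open>The functor \<open>\<phi>\<^sub>*\<close> induced by a graph morphism \<open>\<phi>\<close> into \<open>H\<close>.\<close>

definition induced_functor ::
  "'b pair_pre_digraph \<Rightarrow> ('a \<Rightarrow> 'b) \<Rightarrow> ('a, 'a list set, 'b, 'b list set) funct" where
  "induced_functor H \<phi> =
     \<lparr> omap = \<phi>, amap = (\<lambda>A. \<Union>\<alpha> \<in> A. walk_class H (map \<phi> \<alpha>)) \<rparr>"

definition parity_functor :: "('a, 'a list set, unit, bit) funct" where
  "parity_functor =
     \<lparr> omap = (\<lambda>_. ()), amap = (\<lambda>A. the_elem ((\<lambda>\<alpha>. of_nat (walk_length \<alpha>)) ` A)) \<rparr>"

definition parity_pullback ::
  "'a pair_pre_digraph \<Rightarrow> 'b pair_pre_digraph \<Rightarrow> ('a \<times> 'b, 'a list set \<times> 'b list set) cat" where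
  "parity_pullback G H = pullback (\<Pi>\<^sub>g G) parity_functor (\<Pi>\<^sub>g H) parity_functor"

definition product_comparison ::
  "'a pair_pre_digraph \<Rightarrow> 'b pair_pre_digraph \<Rightarrow>
   ('a \<times> 'b, ('a \<times> 'b) list set, 'a \<times> 'b, 'a list set \<times> 'b list set) funct" where
  "product_comparison G H = \<lparr>
     omap = (\<lambda>x. x),
     amap = (\<lambda>\<omega>. (amap (induced_functor G fst) \<omega>, amap (induced_functor H snd) \<omega>)) \<rparr>"

end

theory Submission
  imports Defs
begin

text \<open>Up to homotopy rel endpoints, pruning a backtrack can be undone by appending a backtrack at the
  end of the walk. Hence two equivalent walks become homotopic rel endpoints, without any further
  prune, once each is padded by enough backtracks at its end, always towards a chosen neighbour.
  Homotopies of walks of a fixed length lift to the product factor by factor, and padding a walk in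
  the product pads both projections, so classes in the product are determined by their projections.
  Conversely, two walks of the same parity can be padded to the same length and zipped.

  Homotopies are handled through spider moves, which change a single interior vertex.\<close>

section \<open>Categories\<close>

text \<open>The obstacle is length. The two projections of a walk in the product are equally long,
  whereas a prune in one factor shortens one projection only, so a chain of moves in
  \<open>G\<close> that contains prunes has no lift that keeps the \<open>H\<close>-coordinate
  fixed. Spider moves keep the length and do lift in this way, which is why all prunes have to be
  traded for padding.

  Padding uses a neighbour function fixed once and for all. The appended backtrack then depends only
  on the last vertex, which spider moves preserve, so padding is compatible with them; and a pair of
  neighbour functions is a neighbour function on the product. The absence of isolated vertices
  provides such functions.

  What remains is bookkeeping: the numbers of backtracks needed in the two factors arise
  independently, and they are reconciled by comparing lengths.\<close>

text \<open>The inverse functor has a single arrow map for all hom-sets, so injectivity is needed on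
  the union of all of them. Equal images force equal endpoints, because the hom-sets of
  \<open>D\<close> are disjoint and \<open>F\<close> is injective on objects.\<close>

lemma groupoid_isomorphism_if_bij:
  assumes "groupoid C" and "groupoid D" and "is_functor C D F"
    and ob: "bij_betw (omap F) (Ob C) (Ob D)"
    and hom: "\<And>x y. \<lbrakk>x \<in> Ob C; y \<in> Ob C\<rbrakk>
      \<Longrightarrow> bij_betw (amap F) (Hom C x y) (Hom D (omap F x) (omap F y))"
  shows "groupoid_isomorphism C D F"
proof -
  interpret F: is_functor C D F by fact
  define ar where "ar = (\<Union>x\<in>Ob C. \<Union>y\<in>Ob C. Hom C x y)"
  define K where "K = \<lparr>omap = inv_into (Ob C) (omap F), amap = inv_into ar (amap F)\<rparr>"
  have inj: "inj_on (amap F) ar"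
  proof (rule inj_onI)
    fix f g assume "f \<in> ar" "g \<in> ar" and eq: "amap F f = amap F g"
    then obtain x y x' y' where x: "x \<in> Ob C" "y \<in> Ob C" "x' \<in> Ob C" "y' \<in> Ob C"
      and f: "f \<in> Hom C x y" and g: "g \<in> Hom C x' y'"
      by (auto simp: ar_def)
    have "omap F x = omap F x' \<and> omap F y = omap F y'"
      using F.target.Hom_disjoint F.omap_in_Ob F.amap_in_Hom x f g eq by metis
    then have "x = x'" "y = y'"
      using ob x by (auto simp: bij_betw_def inj_on_def)
    with hom[of x y] x f g eq show "f = g"
      by (auto simp: bij_betw_def inj_on_def)
  qed
  have K_ob: "omap K (omap F x) = x" if "x \<in> Ob C" for x
    using ob that by (simp add: K_def bij_betw_def)
  have K_hom: "amap K (amap F f) = f" if "f \<in> Hom C x y" "x \<in> Ob C" "y \<in> Ob C" for f x y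
    using inj that by (auto simp: K_def ar_def intro!: inv_into_f_f)
  have surj_ob: "\<exists>a\<in>Ob C. x = omap F a" if "x \<in> Ob D" for x
    using ob that by (auto simp: bij_betw_def)
  have surj_hom: "\<exists>f'\<in>Hom C x y. f = amap F f'"
    if "f \<in> Hom D (omap F x) (omap F y)" "x \<in> Ob C" "y \<in> Ob C" for f x y
    using hom[of x y] that by (auto simp: bij_betw_def)
  have "is_functor D C K"
  proof
    fix x assume "x \<in> Ob D"
    then obtain a where a: "a \<in> Ob C" "x = omap F a" using surj_ob by blast
    then show "omap K x \<in> Ob C" by (simp add: K_ob)
    have "Ident D x = amap F (Ident C a)" using a F.amap_Ident by simp
    then show "amap K (Ident D x) = Ident C (omap K x)"
      using a K_hom[OF F.source.Ident_in_Hom] by (simp add: K_ob)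
  next
    fix x y f assume *: "x \<in> Ob D" "y \<in> Ob D" "f \<in> Hom D x y"
    obtain a where a: "a \<in> Ob C" "x = omap F a" using surj_ob * by blast
    obtain b where b: "b \<in> Ob C" "y = omap F b" using surj_ob * by blast
    obtain f' where "f' \<in> Hom C a b" "f = amap F f'" using surj_hom * a b by blast
    then show "amap K f \<in> Hom C (omap K x) (omap K y)"
      using a b by (simp add: K_ob K_hom)
  next
    fix x y z f g
    assume *: "x \<in> Ob D" "y \<in> Ob D" "z \<in> Ob D" "f \<in> Hom D x y" "g \<in> Hom D y z"
    obtain a where a: "a \<in> Ob C" "x = omap F a" using surj_ob * by blast
    obtain b where b: "b \<in> Ob C" "y = omap F b" using surj_ob * by blast
    obtain c where c: "c \<in> Ob C" "z = omap F c" using surj_ob * by blast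
    obtain f' where f: "f' \<in> Hom C a b" "f = amap F f'" using surj_hom * a b by blast
    obtain g' where g: "g' \<in> Hom C b c" "g = amap F g'" using surj_hom * b c by blast
    have "Comp D f g = amap F (Comp C f' g')"
      using F.amap_Comp a b c f g by simp
    moreover have "Comp C f' g' \<in> Hom C a c"
      using F.source.Comp_in_Hom a b c f g by blast
    ultimately show "amap K (Comp D f g) = Comp C (amap K f) (amap K g)"
      using a b c f g K_hom by metis
  qed
  moreover have "left_inverse_functor C F K"
    by (simp add: left_inverse_functor_def K_ob K_hom)
  moreover have "left_inverse_functor D K F"
    unfolding left_inverse_functor_def using K_ob K_hom surj_ob surj_hom by metis
  ultimately show ?thesis
    using assms(1-3) by (auto simp: groupoid_isomorphism_def)
qed

text \<open>Inverses are taken componentwise; the point is that the two of them agree in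
  \<open>E\<close>, where only the arrows themselves are known to agree.\<close>

lemma pullback_groupoid:
  assumes "groupoid C" and "groupoid D" and "is_functor C E F" and "is_functor D E K"
  shows "groupoid (pullback C F D K)"
proof -
  interpret C: groupoid C by fact
  interpret D: groupoid D by fact
  interpret F: is_functor C E F by fact
  interpret K: is_functor D E K by fact
  \<comment> \<open>\<open>E\<close> is merely a category, but a left inverse and a right inverse of
    the same arrow always coincide: associate the composite of \<open>g\<close>, \<open>f\<close>
    and \<open>h\<close> in two ways.\<close>
  have inverse_unique: "g = h"
    if "x \<in> Ob E" "y \<in> Ob E" "f \<in> Hom E x y" "g \<in> Hom E y x" "h \<in> Hom E y x"
      "Comp E g f = Ident E y" "Comp E f h = Ident E x" for x y f g h
    using that F.target.Comp_assoc[of y x y x g f h]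
      F.target.Comp_Ident_left[of y x h] F.target.Comp_Ident_right[of y x g] by simp
  show ?thesis
  proof
    fix x y f
    assume "x \<in> Ob (pullback C F D K)" "y \<in> Ob (pullback C F D K)"
      "f \<in> Hom (pullback C F D K) x y"
    then obtain x1 x2 y1 y2 f1 f2 where e: "x = (x1, x2)" "y = (y1, y2)" "f = (f1, f2)"
      and ob: "x1 \<in> Ob C" "x2 \<in> Ob D" "y1 \<in> Ob C" "y2 \<in> Ob D"
        "omap F x1 = omap K x2" "omap F y1 = omap K y2"
      and f: "f1 \<in> Hom C x1 y1" "f2 \<in> Hom D x2 y2" "amap F f1 = amap K f2"
      by (cases x; cases y; cases f) (auto simp: pullback_def)
    obtain g1 where g1: "g1 \<in> Hom C y1 x1" "Comp C f1 g1 = Ident C x1" "Comp C g1 f1 = Ident C y1"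
      using C.inverse_exists ob f by blast
    obtain g2 where g2: "g2 \<in> Hom D y2 x2" "Comp D f2 g2 = Ident D x2" "Comp D g2 f2 = Ident D y2"
      using D.inverse_exists ob f by blast
    have "amap F g1 = amap K g2"
    proof (rule inverse_unique)
      show "omap F x1 \<in> Ob E" "omap F y1 \<in> Ob E" using ob F.omap_in_Ob by blast+
      show "amap F f1 \<in> Hom E (omap F x1) (omap F y1)" "amap F g1 \<in> Hom E (omap F y1) (omap F x1)"
        using ob f g1 F.amap_in_Hom by blast+
      show "amap K g2 \<in> Hom E (omap F y1) (omap F x1)"
        using ob g2 K.amap_in_Hom[of y2 x2 g2] by simp
      show "Comp E (amap F g1) (amap F f1) = Ident E (omap F y1)"
        using F.amap_Comp[of y1 x1 y1 g1 f1] F.amap_Ident ob f g1 by simp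
      show "Comp E (amap F f1) (amap K g2) = Ident E (omap F x1)"
        using K.amap_Comp[of x2 y2 x2 f2 g2] K.amap_Ident ob f g2 by simp
    qed
    then show "\<exists>g\<in>Hom (pullback C F D K) y x.
        Comp (pullback C F D K) f g = Ident (pullback C F D K) x \<and>
        Comp (pullback C F D K) g f = Ident (pullback C F D K) y"
      using e g1 g2 by (intro bexI[of _ "(g1, g2)"]) (auto simp: pullback_def)
  next
    fix x y x' y' f
    assume *: "x \<in> Ob (pullback C F D K)" "y \<in> Ob (pullback C F D K)"
      "x' \<in> Ob (pullback C F D K)" "y' \<in> Ob (pullback C F D K)"
      "f \<in> Hom (pullback C F D K) x y" "f \<in> Hom (pullback C F D K) x' y'"
    obtain x1 x2 y1 y2 u1 u2 v1 v2 f1 f2 where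
      "x = (x1, x2)" "y = (y1, y2)" "x' = (u1, u2)" "y' = (v1, v2)" "f = (f1, f2)"
      by (metis surj_pair)
    with * show "x = x' \<and> y = y'"
      using C.Hom_disjoint[of x1 y1 u1 v1 f1] D.Hom_disjoint[of x2 y2 u2 v2 f2]
      by (simp add: pullback_def)
  next
    fix x assume "x \<in> Ob (pullback C F D K)"
    then show "Ident (pullback C F D K) x \<in> Hom (pullback C F D K) x x"
      by (auto simp: pullback_def C.Ident_in_Hom D.Ident_in_Hom F.amap_Ident K.amap_Ident)
  next
    fix x y f
    assume "x \<in> Ob (pullback C F D K)" "y \<in> Ob (pullback C F D K)"
      "f \<in> Hom (pullback C F D K) x y"
    then show "Comp (pullback C F D K) (Ident (pullback C F D K) x) f = f"
      "Comp (pullback C F D K) f (Ident (pullback C F D K) y) = f"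
      by (auto simp: pullback_def C.Comp_Ident_left D.Comp_Ident_left
          C.Comp_Ident_right D.Comp_Ident_right)
  next
    fix x y z f g
    assume *: "x \<in> Ob (pullback C F D K)" "y \<in> Ob (pullback C F D K)" "z \<in> Ob (pullback C F D K)"
      "f \<in> Hom (pullback C F D K) x y" "g \<in> Hom (pullback C F D K) y z"
    obtain x1 x2 y1 y2 z1 z2 f1 f2 g1 g2 where
      "x = (x1, x2)" "y = (y1, y2)" "z = (z1, z2)" "f = (f1, f2)" "g = (g1, g2)"
      by (metis surj_pair)
    with * show "Comp (pullback C F D K) f g \<in> Hom (pullback C F D K) x z"
      using C.Comp_in_Hom[of x1 y1 z1 f1 g1] D.Comp_in_Hom[of x2 y2 z2 f2 g2]
        F.amap_Comp[of x1 y1 z1 f1 g1] K.amap_Comp[of x2 y2 z2 f2 g2]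
      by (simp add: pullback_def)
  next
    fix w x y z f g h
    assume *: "w \<in> Ob (pullback C F D K)" "x \<in> Ob (pullback C F D K)"
      "y \<in> Ob (pullback C F D K)" "z \<in> Ob (pullback C F D K)"
      "f \<in> Hom (pullback C F D K) w x" "g \<in> Hom (pullback C F D K) x y"
      "h \<in> Hom (pullback C F D K) y z"
    obtain w1 w2 x1 x2 y1 y2 z1 z2 f1 f2 g1 g2 h1 h2 where
      "w = (w1, w2)" "x = (x1, x2)" "y = (y1, y2)" "z = (z1, z2)"
      "f = (f1, f2)" "g = (g1, g2)" "h = (h1, h2)"
      by (metis surj_pair)
    with * show "Comp (pullback C F D K) (Comp (pullback C F D K) f g) h =
        Comp (pullback C F D K) f (Comp (pullback C F D K) g h)"
      using C.Comp_assoc[of w1 x1 y1 z1 f1 g1 h1] D.Comp_assoc[of w2 x2 y2 z2 f2 g2 h2]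
      by (simp add: pullback_def)
  qed
qed

section \<open>Walks as lists\<close>

lemma category_Z2_groupoid: "category Z2_groupoid"
  by unfold_locales (unfold Z2_groupoid_def cat.simps, (rule add.assoc | simp)+)

lemma is_walk_map:
  assumes "graph_hom G H f" and "is_walk G \<alpha>"
  shows "is_walk H (map f \<alpha>)"
proof -
  \<comment> \<open>\<open>walk_length\<close> is a truncated subtraction, so this bound relies on a
    walk being nonempty.\<close>
  have "i < length \<alpha>" if "i \<le> walk_length \<alpha>" for i
    using assms(2) that by (cases \<alpha>) (auto simp: is_walk_def)
  then show ?thesis
    using assms by (auto simp: is_walk_def graph_hom_def path_graph_def)
qed

lemma is_walk_zip:
  assumes "is_walk G \<alpha>" and "is_walk H \<beta>" and "length \<alpha> = length \<beta>"
  shows "is_walk (G \<times>\<^sub>g H) (zip \<alpha> \<beta>)"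
proof -
  have "i < length \<alpha>" if "i \<le> walk_length \<alpha>" for i
    using assms(1) that by (cases \<alpha>) (auto simp: is_walk_def)
  then show ?thesis
    using assms by (auto simp: is_walk_def graph_hom_def path_graph_def graph_prod_def)
qed

section \<open>Elementary moves on walks\<close>

text \<open>The split form, instead of an index and a list update, passes directly through
  \<open>map\<close>, \<open>zip\<close> and appending. Having \<open>a\<close> and \<open>b\<close>
  around the changed vertex keeps both endpoints fixed.\<close>

inductive spider_move :: "'a pair_pre_digraph \<Rightarrow> 'a list \<Rightarrow> 'a list \<Rightarrow> bool" for G where
  spider: "\<lbrakk>is_walk G (p @ [a, x, b] @ q); is_walk G (p @ [a, y, b] @ q)\<rbrakk>
    \<Longrightarrow> spider_move G (p @ [a, x, b] @ q) (p @ [a, y, b] @ q)"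

text \<open>Only the longer list is required to be a walk; the shorter one then is a walk as
  well.\<close>

inductive prune_move :: "'a pair_pre_digraph \<Rightarrow> 'a list \<Rightarrow> 'a list \<Rightarrow> bool" for G where
  prune: "is_walk G (p @ [a, x, a] @ q) \<Longrightarrow> prune_move G (p @ [a, x, a] @ q) (p @ [a] @ q)"

definition elementary_move :: "'a pair_pre_digraph \<Rightarrow> 'a list \<Rightarrow> 'a list \<Rightarrow> bool" where
  "elementary_move G \<alpha> \<beta> \<longleftrightarrow> spider_move G \<alpha> \<beta> \<or> prune_move G \<alpha> \<beta>"

abbreviation spider_equiv :: "'a pair_pre_digraph \<Rightarrow> 'a list \<Rightarrow> 'a list \<Rightarrow> bool" where
  "spider_equiv G \<equiv> equivclp (spider_move G)"

abbreviation walk_equiv :: "'a pair_pre_digraph \<Rightarrow> 'a list \<Rightarrow> 'a list \<Rightarrow> bool" where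
  "walk_equiv G \<equiv> equivclp (elementary_move G)"

lemma elementary_moveE:
  assumes "elementary_move G \<alpha> \<beta>"
  obtains (spider) p a x b q y where "\<alpha> = p @ [a, x, b] @ q" "\<beta> = p @ [a, y, b] @ q"
      "is_walk G (p @ [a, x, b] @ q)" "is_walk G (p @ [a, y, b] @ q)"
    | (prune) p a x q where "\<alpha> = p @ [a, x, a] @ q" "\<beta> = p @ [a] @ q"
      "is_walk G (p @ [a, x, a] @ q)"
  using assms unfolding elementary_move_def
  by (auto elim!: spider_move.cases prune_move.cases)

lemma equivclp_map:
  assumes "equivclp r x y" and "\<And>x y. r x y \<Longrightarrow> equivclp s (f x) (f y)"
  shows "equivclp s (f x) (f y)"
  using assms(1)
proof (induction rule: equivclp_induct)
  case (step y z)
  then show ?case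
    using assms(2) by (meson equivclp_sym equivclp_trans)
qed simp

lemma equivclp_subset:
  assumes "equivclp r x y" and "\<And>x y. r x y \<Longrightarrow> equivclp s x y"
  shows "equivclp s x y"
  using equivclp_map[of r x y s "\<lambda>x. x"] assms by simp

lemma spider_equiv_imp_walk_equiv:
  "spider_equiv G \<alpha> \<beta> \<Longrightarrow> walk_equiv G \<alpha> \<beta>"
  by (erule equivclp_subset) (auto simp: elementary_move_def)

lemma spider_move_map:
  assumes "graph_hom G H f" and "spider_move G \<alpha> \<beta>"
  shows "spider_move H (map f \<alpha>) (map f \<beta>)"
  using assms(2)
proof cases
  case (spider p a x b q y)
  show ?thesis
    using spider_move.spider[of H "map f p" "f a" "f x" "f b" "map f q" "f y"]
      is_walk_map[OF assms(1) spider(3)] is_walk_map[OF assms(1) spider(4)] spider(1,2) by simp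
qed

lemma prune_move_map:
  assumes "graph_hom G H f" and "prune_move G \<alpha> \<beta>"
  shows "prune_move H (map f \<alpha>) (map f \<beta>)"
  using assms(2)
proof cases
  case (prune p a x q)
  show ?thesis
    using prune_move.prune[of H "map f p" "f a" "f x" "map f q"]
      is_walk_map[OF assms(1) prune(3)] prune(1,2) by simp
qed

lemma walk_equiv_map:
  assumes "graph_hom G H f" and "walk_equiv G \<alpha> \<beta>"
  shows "walk_equiv H (map f \<alpha>) (map f \<beta>)"
  using assms(2)
proof (rule equivclp_map)
  fix \<alpha> \<beta> assume "elementary_move G \<alpha> \<beta>"
  then show "walk_equiv H (map f \<alpha>) (map f \<beta>)"
    using spider_move_map[OF assms(1)] prune_move_map[OF assms(1)]
    by (auto simp: elementary_move_def intro!: r_into_equivclp)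
qed

context pair_sym_digraph
begin

lemma parcs_sym: "(v, w) \<in> parcs G \<Longrightarrow> (w, v) \<in> parcs G"
  using pair_sym_arcs by (auto simp: symmetric_def sym_def)

text \<open>\<open>path_graph\<close> has arcs in both directions, and symmetry of \<open>G\<close>
  supplies the backward ones. The condition on vertices is what decides whether a list with one
  entry is a walk.\<close>

lemma is_walk_iff:
  "is_walk G \<alpha> \<longleftrightarrow>
    \<alpha> \<noteq> [] \<and> set \<alpha> \<subseteq> pverts G \<and> successively (\<lambda>v w. (v, w) \<in> parcs G) \<alpha>"
proof (cases "\<alpha> = []")
  case False
  then have "i \<le> walk_length \<alpha> \<longleftrightarrow> i < length \<alpha>" for i
    by (cases \<alpha>) auto
  moreover have "set \<alpha> \<subseteq> pverts G \<longleftrightarrow> (\<forall>i < length \<alpha>. \<alpha> ! i \<in> pverts G)"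
    by (auto simp: set_conv_nth)
  ultimately show ?thesis
    using False by (auto simp: is_walk_def graph_hom_def path_graph_def successively_conv_nth
        intro: parcs_sym)
qed (simp add: is_walk_def)

lemma elementary_move_walks:
  "elementary_move G \<alpha> \<beta> \<Longrightarrow> \<alpha> \<in> walks G x y \<longleftrightarrow> \<beta> \<in> walks G x y"
  by (erule elementary_moveE)
    (auto simp: walks_def hd_append is_walk_iff successively_append_iff successively_Cons)

lemma walk_equiv_walks:
  assumes "walk_equiv G \<alpha> \<beta>"
  shows "\<alpha> \<in> walks G x y \<longleftrightarrow> \<beta> \<in> walks G x y"
  using assms by (induction rule: equivclp_induct) (auto simp: elementary_move_walks)

lemma walk_equiv_even_length:
  assumes "walk_equiv G \<alpha> \<beta>"
  shows "even (length \<alpha>) \<longleftrightarrow> even (length \<beta>)"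
  using assms by (induction rule: equivclp_induct) (auto elim!: elementary_moveE)

section \<open>Homotopies as chains of spider moves\<close>

lemma prunes_to_imp_prune_move:
  assumes "is_walk G \<alpha>" and "prunes_to \<alpha> \<beta>"
  shows "prune_move G \<alpha> \<beta>"
proof -
  obtain i where i: "i + 2 < length \<alpha>" "\<alpha> ! i = \<alpha> ! (i + 2)" "\<beta> = take i \<alpha> @ drop (i + 2) \<alpha>"
    using assms(2) by (auto simp: prunes_to_def)
  have d: "drop (i + 2) \<alpha> = \<alpha> ! i # drop (i + 3) \<alpha>"
    using i Cons_nth_drop_Suc[of "i + 2" \<alpha>] by (simp add: numeral_3_eq_3)
  have "drop i \<alpha> = \<alpha> ! i # \<alpha> ! (i + 1) # drop (i + 2) \<alpha>"
    using i Cons_nth_drop_Suc[of i \<alpha>] Cons_nth_drop_Suc[of "i + 1" \<alpha>] by simp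
  then have "\<alpha> = take i \<alpha> @ [\<alpha> ! i, \<alpha> ! (i + 1), \<alpha> ! i] @ drop (i + 3) \<alpha>"
    using d append_take_drop_id[of i \<alpha>] by simp
  then show ?thesis
    using prune_move.prune[of G "take i \<alpha>" "\<alpha> ! i" "\<alpha> ! (i + 1)" "drop (i + 3) \<alpha>"] assms(1) d i(3)
    by simp
qed

text \<open>Replace the entries of \<alpha> by those of \<beta> one at a time from the left. Each
  intermediate list has a single seam, from an entry of \<beta> to the next entry of \<alpha>, and
  \<open>adj\<close> provides exactly that arc.\<close>

lemma spider_equiv_if_adjacent:
  assumes \<alpha>: "is_walk G \<alpha>" and \<beta>: "is_walk G \<beta>" and len: "length \<alpha> = length \<beta>"
    and ends: "hd \<alpha> = hd \<beta>" "last \<alpha> = last \<beta>"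
    and adj: "\<And>i. Suc i < length \<alpha> \<Longrightarrow> (\<beta> ! i, \<alpha> ! Suc i) \<in> parcs G"
  shows "spider_equiv G \<alpha> \<beta>"
proof -
  define mixed where "mixed k = take k \<beta> @ drop k \<alpha>" for k
  have walk: "is_walk G (mixed k)" if "k \<le> length \<alpha>" for k
  proof -
    have "successively (\<lambda>v w. (v, w) \<in> parcs G) (mixed k)"
      unfolding successively_conv_nth
    proof (intro allI impI)
      fix i assume "Suc i < length (mixed k)"
      then have "Suc i < length \<alpha>" using len by (simp add: mixed_def)
      moreover from this have "(\<alpha> ! i, \<alpha> ! Suc i) \<in> parcs G" "(\<beta> ! i, \<beta> ! Suc i) \<in> parcs G"
        using \<alpha> \<beta> len by (auto simp: is_walk_iff successively_conv_nth)
      ultimately show "(mixed k ! i, mixed k ! Suc i) \<in> parcs G"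
        using adj[of i] len that by (auto simp: mixed_def nth_append min_def)
    qed
    moreover have "mixed k \<noteq> []" "set (mixed k) \<subseteq> pverts G"
      using \<alpha> \<beta> len that
      by (auto simp: mixed_def is_walk_iff dest: in_set_takeD in_set_dropD)
    ultimately show ?thesis by (simp add: is_walk_iff)
  qed
  have "spider_equiv G \<alpha> (mixed k)" if "k \<le> length \<alpha>" for k
    using that
  proof (induction k)
    case 0
    then show ?case by (simp add: mixed_def)
  next
    case (Suc k)
    have \<alpha>k: "drop k \<alpha> = \<alpha> ! k # drop (Suc k) \<alpha>"
      using Suc.prems by (simp add: Cons_nth_drop_Suc)
    have \<beta>k: "take (Suc k) \<beta> = take k \<beta> @ [\<beta> ! k]"
      using Suc.prems len by (simp add: take_Suc_conv_app_nth)
    have "spider_equiv G (mixed k) (mixed (Suc k))"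
    \<comment> \<open>At either end the entries already agree and nothing changes. Everywhere else
      the replaced vertex is interior, between \<open>\<beta> ! (k - 1)\<close> and
      \<open>\<alpha> ! Suc k\<close>, so the replacement is a spider move.\<close>
    proof (cases "k = 0 \<or> Suc k = length \<alpha>")
      case True
      then have "\<alpha> ! k = \<beta> ! k"
      proof
        assume "k = 0"
        with \<alpha> \<beta> ends show ?thesis by (simp add: is_walk_iff hd_conv_nth)
      next
        assume "Suc k = length \<alpha>"
        then have "k = length \<alpha> - 1" by simp
        with \<alpha> \<beta> ends len show ?thesis by (simp add: is_walk_iff last_conv_nth)
      qed
      then show ?thesis by (simp add: mixed_def \<alpha>k \<beta>k)
    next
      case False
      then obtain i where i: "k = Suc i" by (cases k) auto
      have "take k \<beta> = take i \<beta> @ [\<beta> ! i]"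
        using Suc.prems len i by (simp add: take_Suc_conv_app_nth)
      moreover have "drop (Suc k) \<alpha> = \<alpha> ! Suc k # drop (Suc (Suc k)) \<alpha>"
        using Suc.prems False by (simp add: Cons_nth_drop_Suc)
      ultimately have e: "mixed k = take i \<beta> @ [\<beta> ! i, \<alpha> ! k, \<alpha> ! Suc k] @ drop (Suc (Suc k)) \<alpha>"
        "mixed (Suc k) = take i \<beta> @ [\<beta> ! i, \<beta> ! k, \<alpha> ! Suc k] @ drop (Suc (Suc k)) \<alpha>"
        unfolding mixed_def \<alpha>k \<beta>k by simp_all
      have "spider_move G (mixed k) (mixed (Suc k))"
        unfolding e by (rule spider_move.spider) (use walk[of k] walk[of "Suc k"] Suc.prems in \<open>simp_all add: e\<close>)
      then show ?thesis ..
    qed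
    with Suc.IH Suc.prems show ?case by (meson Suc_leD equivclp_trans)
  qed
  from this[of "length \<alpha>"] show ?thesis by (simp add: mixed_def len)
qed

text \<open>Read the homotopy row by row. The product of the path with the looped path contains the
  diagonals between neighbouring rows, which is the adjacency that the preceding interpolation asks
  for.\<close>

lemma homotopic_imp_spider_equiv:
  assumes \<alpha>: "is_walk G \<alpha>" and \<beta>: "is_walk G \<beta>" and "homotopic_rel_endpoints G \<alpha> \<beta>"
  shows "spider_equiv G \<alpha> \<beta>"
proof -
  define n where "n = walk_length \<alpha>"
  have n: "length \<alpha> = Suc n" using \<alpha> by (simp add: n_def is_walk_iff)
  obtain m \<Lambda> where len: "length \<alpha> = length \<beta>"
    and hom: "graph_hom (path_graph n \<times>\<^sub>g looped_path_graph m) G \<Lambda>"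
    and rows: "\<And>i. i \<le> n \<Longrightarrow> \<Lambda> (i, 0) = \<alpha> ! i" "\<And>i. i \<le> n \<Longrightarrow> \<Lambda> (i, m) = \<beta> ! i"
    and ends: "\<And>j. j \<le> m \<Longrightarrow> \<Lambda> (0, j) = hd \<alpha>" "\<And>j. j \<le> m \<Longrightarrow> \<Lambda> (n, j) = last \<alpha>"
    using assms(3) unfolding homotopic_rel_endpoints_def n_def by blast
  define row where "row j = map (\<lambda>i. \<Lambda> (i, j)) [0..<Suc n]" for j
  have len_row: "length (row j) = Suc n" for j by (simp add: row_def)
  have nth_row: "row j ! i = \<Lambda> (i, j)" if "i \<le> n" for i j
    using that unfolding row_def by (subst nth_map) (auto simp del: upt_Suc)
  \<comment> \<open>The case \<open>k = j\<close> comes from the loops of the second factor and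
    makes each row a walk; the other two cases are the diagonals.\<close>
  have arc: "(\<Lambda> (i, j), \<Lambda> (Suc i, k)) \<in> parcs G"
    if "Suc i \<le> n" "j \<le> m" "k \<le> m" "k = j \<or> k = Suc j \<or> j = Suc k" for i j k
    using hom that by (auto simp: graph_hom_def graph_prod_def path_graph_def looped_path_graph_def)
  have vert: "\<Lambda> (i, j) \<in> pverts G" if "i \<le> n" "j \<le> m" for i j
    using hom that by (auto simp: graph_hom_def graph_prod_def path_graph_def looped_path_graph_def)
  have walk: "is_walk G (row j)" if "j \<le> m" for j
    using that by (auto simp: is_walk_iff successively_conv_nth in_set_conv_nth len_row nth_row
        arc vert less_Suc_eq_le simp flip: length_0_conv)
  have hd_row: "hd (row j) = hd \<alpha>" and last_row: "last (row j) = last \<alpha>" if "j \<le> m" for j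
  proof -
    have "row j \<noteq> []" using len_row[of j] by auto
    then show "hd (row j) = hd \<alpha>" "last (row j) = last \<alpha>"
      using that by (simp_all add: hd_conv_nth last_conv_nth nth_row ends len_row)
  qed
  have "spider_equiv G (row 0) (row j)" if "j \<le> m" for j
    using that
  proof (induction j)
    case (Suc j)
    have "spider_equiv G (row j) (row (Suc j))"
      using Suc.prems
      by (intro spider_equiv_if_adjacent)
        (auto simp: walk len_row nth_row hd_row last_row intro!: arc)
    with Suc.IH Suc.prems show ?case by (meson Suc_leD equivclp_trans)
  qed simp
  moreover have "row 0 = \<alpha>" "row m = \<beta>"
    using n len by (auto intro!: nth_equalityI simp: len_row nth_row rows less_Suc_eq_le)
  ultimately show ?thesis by blast
qed

text \<open>The two walks themselves are the two rows of a homotopy with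
  \<open>m = 1\<close>.\<close>

lemma spider_move_imp_homotopic:
  assumes "spider_move G \<alpha> \<beta>"
  shows "homotopic_rel_endpoints G \<alpha> \<beta>"
  using assms
proof cases
  case (spider p a x b q y)
  define n where "n = walk_length \<alpha>"
  have len: "length \<alpha> = Suc n" "length \<beta> = Suc n" using spider by (auto simp: n_def)
  have hd_last: "hd \<alpha> = hd \<beta>" "last \<alpha> = last \<beta>"
    using spider by (auto simp: hd_append)
  have same: "\<alpha> ! i = \<beta> ! i" if "i \<noteq> Suc (length p)" for i
    using spider that by (auto simp: nth_append nth_Cons split: nat.splits)
  have arcs: "(\<alpha> ! i, \<alpha> ! Suc i) \<in> parcs G" "(\<beta> ! i, \<beta> ! Suc i) \<in> parcs G" if "i < n" for i
    using spider that len by (auto simp: is_walk_iff successively_conv_nth)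
  \<comment> \<open>The walks differ in at most one position, so they agree at \<open>i\<close> or
    at \<open>Suc i\<close>, and each diagonal is an arc of one of the walks.\<close>
  then have arcs': "(\<alpha> ! i, \<beta> ! Suc i) \<in> parcs G" "(\<beta> ! i, \<alpha> ! Suc i) \<in> parcs G" if "i < n" for i
    using that by (metis same n_not_Suc_n)+
  have vert: "\<alpha> ! i \<in> pverts G" "\<beta> ! i \<in> pverts G" if "i \<le> n" for i
    using spider that len nth_mem[of i \<alpha>] nth_mem[of i \<beta>]
    unfolding is_walk_iff by (metis le_imp_less_Suc subsetD)+
  define \<Lambda> where "\<Lambda> = (\<lambda>(i :: nat, j :: nat). if j = 0 then \<alpha> ! i else \<beta> ! i)"
  have "graph_hom (path_graph n \<times>\<^sub>g looped_path_graph 1) G \<Lambda>"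
    by (auto simp: graph_hom_def graph_prod_def path_graph_def looped_path_graph_def \<Lambda>_def
        vert Suc_le_eq arcs arcs' arcs[THEN parcs_sym] arcs'[THEN parcs_sym])
  moreover have "\<Lambda> (0, j) = hd \<alpha> \<and> \<Lambda> (n, j) = last \<alpha>" for j
    using hd_last len by (simp add: \<Lambda>_def hd_conv_nth last_conv_nth flip: length_0_conv)
  ultimately show ?thesis
    unfolding homotopic_rel_endpoints_def n_def[symmetric]
    using len by (intro conjI exI[of _ 1] exI[of _ \<Lambda>]) (auto simp: \<Lambda>_def)
qed

lemma prune_move_imp_prunes_to: "prune_move G \<alpha> \<beta> \<Longrightarrow> prunes_to \<alpha> \<beta>"
proof (erule prune_move.cases)
  fix p a x q assume e: "\<alpha> = p @ [a, x, a] @ q" "\<beta> = p @ [a] @ q"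
  then have "\<alpha> ! length p = \<alpha> ! (length p + 2)"
    by (simp add: nth_append)
  with e show "prunes_to \<alpha> \<beta>"
    unfolding prunes_to_def by (intro exI[of _ "length p"]) simp
qed

text \<open>This replaces arbitrary homotopies by local moves, so that later inductions have only
  two cases.\<close>

lemma walk_equiv_eq: "walk_equiv G = equivclp (walk_step G)"
proof (intro ext iffI)
  fix \<alpha> \<beta> assume "walk_equiv G \<alpha> \<beta>"
  then show "equivclp (walk_step G) \<alpha> \<beta>"
  proof (rule equivclp_subset)
    fix \<alpha> \<beta> assume *: "elementary_move G \<alpha> \<beta>"
    then have "is_walk G \<alpha>"
      by (auto elim!: elementary_moveE)
    moreover have "is_walk G \<beta>"
      using \<open>is_walk G \<alpha>\<close> elementary_move_walks[OF *] by (auto simp: walks_def)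
    ultimately show "equivclp (walk_step G) \<alpha> \<beta>"
      using * prune_move_imp_prunes_to spider_move_imp_homotopic
      by (auto simp: walk_step_def elementary_move_def)
  qed
next
  fix \<alpha> \<beta> assume "equivclp (walk_step G) \<alpha> \<beta>"
  then show "walk_equiv G \<alpha> \<beta>"
  proof (rule equivclp_subset)
    fix \<alpha> \<beta> assume "walk_step G \<alpha> \<beta>"
    then show "walk_equiv G \<alpha> \<beta>"
      using prunes_to_imp_prune_move[of \<alpha> \<beta>] homotopic_imp_spider_equiv[of \<alpha> \<beta>]
      by (auto simp: walk_step_def elementary_move_def intro: spider_equiv_imp_walk_equiv)
  qed
qed


section \<open>Concatenation, inverses and the fundamental groupoid\<close>

lemma walk_class_eq: "walk_class G \<alpha> = {\<beta>. walk_equiv G \<alpha> \<beta>}"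
  by (simp add: walk_class_def walk_equiv_eq)

lemma walk_class_eq_iff: "walk_class G \<alpha> = walk_class G \<beta> \<longleftrightarrow> walk_equiv G \<alpha> \<beta>"
  unfolding walk_class_eq set_eq_iff mem_Collect_eq
  by (meson equivclp_refl equivclp_sym equivclp_trans)

text \<open>A move keeps the first and the last entry, hence the arcs that join it to what precedes
  and follows.\<close>

lemma elementary_move_is_walk_append:
  "elementary_move G \<alpha> \<beta> \<Longrightarrow> is_walk G (\<gamma> @ \<alpha> @ \<delta>) \<longleftrightarrow> is_walk G (\<gamma> @ \<beta> @ \<delta>)"
  by (erule elementary_moveE)
    (auto simp: is_walk_iff successively_append_iff successively_Cons hd_append)

lemma elementary_move_append:
  assumes "elementary_move G \<alpha> \<beta>" and "is_walk G (\<gamma> @ \<alpha> @ \<delta>)"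
  shows "elementary_move G (\<gamma> @ \<alpha> @ \<delta>) (\<gamma> @ \<beta> @ \<delta>)"
proof -
  have "is_walk G (\<gamma> @ \<beta> @ \<delta>)"
    using assms elementary_move_is_walk_append by blast
  with assms show ?thesis
    using spider_move.spider[of G "\<gamma> @ p" a x b "q @ \<delta>" y for p a x b q y]
      prune_move.prune[of G "\<gamma> @ p" a x "q @ \<delta>" for p a x q]
    by (elim elementary_moveE) (simp_all add: elementary_move_def)
qed

lemma walk_equiv_append:
  assumes "walk_equiv G \<alpha> \<beta>" and "is_walk G (\<gamma> @ \<alpha> @ \<delta>)"
  shows "walk_equiv G (\<gamma> @ \<alpha> @ \<delta>) (\<gamma> @ \<beta> @ \<delta>)"
proof -
  \<comment> \<open>The induction carries walkness along because extending the next move requires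
    it.\<close>
  have "is_walk G (\<gamma> @ \<beta> @ \<delta>) \<and> walk_equiv G (\<gamma> @ \<alpha> @ \<delta>) (\<gamma> @ \<beta> @ \<delta>)"
    using assms(1)
  proof (induction rule: equivclp_induct)
    case (step y z)
    then have "is_walk G (\<gamma> @ z @ \<delta>)"
      using elementary_move_is_walk_append by blast
    with step show ?case
      using elementary_move_append equivclp_into_equivclp by metis
  qed (use assms(2) in simp)
  then show ?thesis ..
qed

lemma walk_concat_walks:
  assumes "\<alpha> \<in> walks G x y" and "\<beta> \<in> walks G y z"
  shows "walk_concat \<alpha> \<beta> \<in> walks G x z"
  using assms
  by (cases \<beta>) (auto simp: walks_def walk_concat_def is_walk_iff successively_append_iff
      successively_Cons)

text \<open>\<open>walk_concat\<close> cuts off the head of its second argument. This form keeps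
  \<beta> whole, so that moves inside \<beta> can be applied in context.\<close>

lemma walk_concat_eq_butlast:
  assumes "\<alpha> \<in> walks G x y" and "\<beta> \<in> walks G y z"
  shows "walk_concat \<alpha> \<beta> = butlast \<alpha> @ \<beta>"
proof -
  have "\<alpha> = butlast \<alpha> @ [y]" "\<beta> = y # tl \<beta>"
    using assms by (auto simp: walks_def is_walk_iff dest: hd_Cons_tl)
  then show ?thesis
    unfolding walk_concat_def by (metis append.assoc append_Cons append_Nil)
qed

lemma walk_concat_cong:
  assumes \<alpha>: "\<alpha> \<in> walks G x y" and \<beta>: "\<beta> \<in> walks G y z"
    and "walk_equiv G \<alpha> \<alpha>'" and "walk_equiv G \<beta> \<beta>'"
  shows "walk_equiv G (walk_concat \<alpha> \<beta>) (walk_concat \<alpha>' \<beta>')"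
proof -
  have \<alpha>': "\<alpha>' \<in> walks G x y" and \<beta>': "\<beta>' \<in> walks G y z"
    using assms walk_equiv_walks by blast+
  have "walk_equiv G (walk_concat \<alpha> \<beta>) (walk_concat \<alpha>' \<beta>)"
    using walk_equiv_append[of \<alpha> \<alpha>' "[]" "tl \<beta>"] assms(3) walk_concat_walks[OF \<alpha> \<beta>]
    by (simp add: walk_concat_def walks_def)
  also have "walk_equiv G (walk_concat \<alpha>' \<beta>) (walk_concat \<alpha>' \<beta>')"
    using walk_equiv_append[of \<beta> \<beta>' "butlast \<alpha>'" "[]"] assms(4) walk_concat_walks[OF \<alpha>' \<beta>]
    by (simp add: walk_concat_eq_butlast[OF \<alpha>' \<beta>] walk_concat_eq_butlast[OF \<alpha>' \<beta>'] walks_def)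
  finally show ?thesis .
qed

lemma is_walk_rev:
  assumes "is_walk G \<alpha>"
  shows "is_walk G (rev \<alpha>)"
proof -
  have "successively (\<lambda>x y. (y, x) \<in> parcs G) \<alpha>"
    using assms unfolding is_walk_iff by (auto intro: successively_mono parcs_sym)
  with assms show ?thesis unfolding is_walk_iff successively_rev by simp
qed

text \<open>The walk out and back has a backtrack at its turning point. Pruning it leaves the same
  composite for the walk without its last vertex.\<close>

lemma walk_concat_rev:
  assumes "is_walk G \<alpha>"
  shows "walk_equiv G (walk_concat \<alpha> (rev \<alpha>)) [hd \<alpha>]"
proof -
  have "\<alpha> \<noteq> []" using assms by (simp add: is_walk_iff)
  then show ?thesis
    using assms
  proof (induction \<alpha> rule: rev_nonempty_induct)
    case (snoc y \<alpha>)
    then obtain \<gamma> z where \<gamma>: "\<alpha> = \<gamma> @ [z]" by (metis rev_exhaust)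
    have walk: "is_walk G (\<gamma> @ [z, y, z] @ rev \<gamma>)"
      using snoc.prems is_walk_rev[OF snoc.prems] \<gamma>
      by (auto simp: is_walk_iff successively_append_iff successively_Cons)
    have "is_walk G \<alpha>"
      using snoc.prems \<gamma> by (auto simp: is_walk_iff successively_append_iff)
    then have "walk_equiv G (\<gamma> @ [z] @ rev \<gamma>) [hd \<alpha>]"
      using snoc.IH \<gamma> by (simp add: walk_concat_def)
    moreover have "walk_equiv G (\<gamma> @ [z, y, z] @ rev \<gamma>) (\<gamma> @ [z] @ rev \<gamma>)"
      using prune_move.prune[OF walk] by (auto simp: elementary_move_def intro!: r_into_equivclp)
    ultimately have "walk_equiv G (\<gamma> @ [z, y, z] @ rev \<gamma>) [hd \<alpha>]"
      by (rule equivclp_trans[rotated])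
    then show ?case using \<gamma> by (cases \<gamma>) (simp_all add: walk_concat_def)
  qed (simp add: walk_concat_def)
qed

lemma rev_walks:
  assumes "\<alpha> \<in> walks G x y"
  shows "rev \<alpha> \<in> walks G y x"
  using assms is_walk_rev[of \<alpha>] by (auto simp: walks_def hd_rev last_rev)

lemma fund_groupoid_Comp:
  assumes "\<alpha> \<in> walks G x y" and "\<beta> \<in> walks G y z"
  shows "Comp (\<Pi>\<^sub>g G) (walk_class G \<alpha>) (walk_class G \<beta>) = walk_class G (walk_concat \<alpha> \<beta>)"
proof -
  have "walk_class G (walk_concat \<alpha>' \<beta>') \<subseteq> walk_class G (walk_concat \<alpha> \<beta>)"
    if "\<alpha>' \<in> walk_class G \<alpha>" "\<beta>' \<in> walk_class G \<beta>" for \<alpha>' \<beta>'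
    using that walk_concat_cong[OF assms] walk_class_eq_iff walk_class_eq by blast
  moreover have "\<alpha> \<in> walk_class G \<alpha>" "\<beta> \<in> walk_class G \<beta>"
    by (simp_all add: walk_class_eq)
  ultimately show ?thesis
    unfolding fund_groupoid_def cat.simps by blast
qed

lemma trivial_walk: "x \<in> pverts G \<Longrightarrow> [x] \<in> walks G x x"
  by (simp add: walks_def is_walk_iff)

lemma groupoid_fund_groupoid: "groupoid (\<Pi>\<^sub>g G)"
proof
  fix x y x' y' f
  assume "f \<in> Hom (\<Pi>\<^sub>g G) x y" "f \<in> Hom (\<Pi>\<^sub>g G) x' y'"
  then obtain \<alpha> \<beta> where "\<alpha> \<in> walks G x y" "\<beta> \<in> walks G x' y'" "walk_class G \<alpha> = walk_class G \<beta>"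
    by (auto simp: fund_groupoid_def)
  then show "x = x' \<and> y = y'"
    using walk_equiv_walks[of \<alpha> \<beta> x y] by (auto simp: walk_class_eq_iff walks_def)
next
  fix x assume "x \<in> Ob (\<Pi>\<^sub>g G)"
  then show "Ident (\<Pi>\<^sub>g G) x \<in> Hom (\<Pi>\<^sub>g G) x x"
    by (auto simp: fund_groupoid_def trivial_walk)
next
  fix x y z f g
  assume "f \<in> Hom (\<Pi>\<^sub>g G) x y" "g \<in> Hom (\<Pi>\<^sub>g G) y z"
  then obtain \<alpha> \<beta> where "\<alpha> \<in> walks G x y" "\<beta> \<in> walks G y z"
    "f = walk_class G \<alpha>" "g = walk_class G \<beta>"
    by (auto simp: fund_groupoid_def)
  then show "Comp (\<Pi>\<^sub>g G) f g \<in> Hom (\<Pi>\<^sub>g G) x z"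
    using fund_groupoid_Comp walk_concat_walks by (auto simp: fund_groupoid_def)
next
  fix x y f
  assume "x \<in> Ob (\<Pi>\<^sub>g G)" "y \<in> Ob (\<Pi>\<^sub>g G)" "f \<in> Hom (\<Pi>\<^sub>g G) x y"
  then obtain \<alpha> where \<alpha>: "\<alpha> \<in> walks G x y" "f = walk_class G \<alpha>" and xy: "x \<in> pverts G" "y \<in> pverts G"
    by (auto simp: fund_groupoid_def)
  have id: "Ident (\<Pi>\<^sub>g G) z = walk_class G [z]" for z by (simp add: fund_groupoid_def)
  have "x # tl \<alpha> = \<alpha>" using \<alpha> by (auto simp: walks_def is_walk_iff)
  then show "Comp (\<Pi>\<^sub>g G) (Ident (\<Pi>\<^sub>g G) x) f = f" "Comp (\<Pi>\<^sub>g G) f (Ident (\<Pi>\<^sub>g G) y) = f"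
    using fund_groupoid_Comp[OF trivial_walk \<alpha>(1)] fund_groupoid_Comp[OF \<alpha>(1) trivial_walk] \<alpha> xy
    by (simp_all add: id walk_concat_def)
  have r: "rev \<alpha> \<in> walks G y x" using \<alpha> rev_walks by blast
  have "Comp (\<Pi>\<^sub>g G) f (walk_class G (rev \<alpha>)) = Ident (\<Pi>\<^sub>g G) x"
    using fund_groupoid_Comp[OF \<alpha>(1) r] walk_concat_rev[of \<alpha>] \<alpha>
    by (simp add: id walk_class_eq_iff walks_def)
  moreover have "Comp (\<Pi>\<^sub>g G) (walk_class G (rev \<alpha>)) f = Ident (\<Pi>\<^sub>g G) y"
    using fund_groupoid_Comp[OF r \<alpha>(1)] walk_concat_rev[of "rev \<alpha>"] r \<alpha>
    by (simp add: id walk_class_eq_iff walks_def)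
  moreover have "walk_class G (rev \<alpha>) \<in> Hom (\<Pi>\<^sub>g G) y x"
    using r by (simp add: fund_groupoid_def)
  ultimately show "\<exists>g\<in>Hom (\<Pi>\<^sub>g G) y x. Comp (\<Pi>\<^sub>g G) f g = Ident (\<Pi>\<^sub>g G) x \<and>
      Comp (\<Pi>\<^sub>g G) g f = Ident (\<Pi>\<^sub>g G) y"
    by blast
next
  fix w x y z f g h
  assume "f \<in> Hom (\<Pi>\<^sub>g G) w x" "g \<in> Hom (\<Pi>\<^sub>g G) x y" "h \<in> Hom (\<Pi>\<^sub>g G) y z"
  then obtain \<alpha> \<beta> \<gamma> where w: "\<alpha> \<in> walks G w x" "\<beta> \<in> walks G x y" "\<gamma> \<in> walks G y z"
    and e: "f = walk_class G \<alpha>" "g = walk_class G \<beta>" "h = walk_class G \<gamma>"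
    by (auto simp: fund_groupoid_def)
  \<comment> \<open>Associativity holds already for lists; that \<beta> is nonempty lets
    \<open>tl\<close> pass through the inner concatenation.\<close>
  have "walk_concat (walk_concat \<alpha> \<beta>) \<gamma> = walk_concat \<alpha> (walk_concat \<beta> \<gamma>)"
    using w(2) by (simp add: walk_concat_def walks_def is_walk_iff)
  then show "Comp (\<Pi>\<^sub>g G) (Comp (\<Pi>\<^sub>g G) f g) h = Comp (\<Pi>\<^sub>g G) f (Comp (\<Pi>\<^sub>g G) g h)"
    using fund_groupoid_Comp[OF w(1,2)] fund_groupoid_Comp[OF walk_concat_walks[OF w(1,2)] w(3)]
      fund_groupoid_Comp[OF w(2,3)] fund_groupoid_Comp[OF w(1) walk_concat_walks[OF w(2,3)]]
    by (simp add: e)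
qed

section \<open>Induced functors and parity\<close>

lemma amap_induced_functor:
  assumes "graph_hom G H f" and "pair_sym_digraph H"
  shows "amap (induced_functor H f) (walk_class G \<alpha>) = walk_class H (map f \<alpha>)"
proof -
  have "walk_class H (map f \<beta>) \<subseteq> walk_class H (map f \<alpha>)" if "\<beta> \<in> walk_class G \<alpha>" for \<beta>
    using that walk_equiv_map[OF assms(1), of \<alpha> \<beta>] walk_class_eq
      pair_sym_digraph.walk_class_eq_iff[OF assms(2)] by blast
  moreover have "\<alpha> \<in> walk_class G \<alpha>" by (simp add: walk_class_eq)
  ultimately show ?thesis
    unfolding induced_functor_def funct.simps by blast
qed

lemma is_functor_induced_functor:
  assumes f: "graph_hom G H f" and H: "pair_sym_digraph H"
  shows "is_functor (\<Pi>\<^sub>g G) (\<Pi>\<^sub>g H) (induced_functor H f)"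
proof -
  interpret H: pair_sym_digraph H by fact
  interpret groupoid "\<Pi>\<^sub>g G" by (rule groupoid_fund_groupoid)
  interpret target: groupoid "\<Pi>\<^sub>g H" by (rule H.groupoid_fund_groupoid)
  have map_walks: "map f \<alpha> \<in> walks H (f x) (f y)" if "\<alpha> \<in> walks G x y" for \<alpha> x y
    using that is_walk_map[OF f] by (auto simp: walks_def is_walk_iff hd_map last_map)
  show ?thesis
  proof
    fix x assume "x \<in> Ob (\<Pi>\<^sub>g G)"
    then show "omap (induced_functor H f) x \<in> Ob (\<Pi>\<^sub>g H)"
      using f by (simp add: fund_groupoid_def induced_functor_def graph_hom_def)
  next
    fix x y g assume "g \<in> Hom (\<Pi>\<^sub>g G) x y"
    then obtain \<alpha> where "\<alpha> \<in> walks G x y" "g = walk_class G \<alpha>"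
      by (auto simp: fund_groupoid_def)
    then show "amap (induced_functor H f) g
        \<in> Hom (\<Pi>\<^sub>g H) (omap (induced_functor H f) x) (omap (induced_functor H f) y)"
      using map_walks[of \<alpha> x y] amap_induced_functor[OF f H, of \<alpha>]
      by (simp add: fund_groupoid_def) (simp add: induced_functor_def)
  next
    fix x
    show "amap (induced_functor H f) (Ident (\<Pi>\<^sub>g G) x)
        = Ident (\<Pi>\<^sub>g H) (omap (induced_functor H f) x)"
      using amap_induced_functor[OF f H, of "[x]"]
      by (simp add: fund_groupoid_def) (simp add: induced_functor_def)
  next
    fix x y z g h assume "g \<in> Hom (\<Pi>\<^sub>g G) x y" "h \<in> Hom (\<Pi>\<^sub>g G) y z"
    then obtain \<alpha> \<beta> where w: "\<alpha> \<in> walks G x y" "\<beta> \<in> walks G y z"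
      and e: "g = walk_class G \<alpha>" "h = walk_class G \<beta>"
      by (auto simp: fund_groupoid_def)
    have "map f (walk_concat \<alpha> \<beta>) = walk_concat (map f \<alpha>) (map f \<beta>)"
      by (simp add: walk_concat_def map_tl)
    then show "amap (induced_functor H f) (Comp (\<Pi>\<^sub>g G) g h)
        = Comp (\<Pi>\<^sub>g H) (amap (induced_functor H f) g) (amap (induced_functor H f) h)"
      using fund_groupoid_Comp[OF w] H.fund_groupoid_Comp[OF map_walks[OF w(1)] map_walks[OF w(2)]]
      by (simp add: e amap_induced_functor[OF f H])
  qed
qed

lemma amap_parity_functor:
  assumes "is_walk G \<alpha>"
  shows "amap parity_functor (walk_class G \<alpha>) = of_nat (walk_length \<alpha>)"
proof -
  have "(of_nat (walk_length \<beta>) :: bit) = of_nat (walk_length \<alpha>)" if "\<beta> \<in> walk_class G \<alpha>" for \<beta>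
  proof -
    have e: "walk_equiv G \<alpha> \<beta>" using that by (simp add: walk_class_eq)
    \<comment> \<open>For a nonempty list, \<open>length\<close> and \<open>walk_length\<close> have
      opposite parity; with truncated subtraction this fails for the empty list.\<close>
    then have "\<beta> \<noteq> []"
      using walk_equiv_walks[of \<alpha> \<beta> "hd \<alpha>" "last \<alpha>"] assms by (auto simp: walks_def is_walk_iff)
    moreover have "\<alpha> \<noteq> []" using assms by (simp add: is_walk_iff)
    ultimately have "even (walk_length \<alpha>) \<longleftrightarrow> even (walk_length \<beta>)"
      using walk_equiv_even_length[OF e] by (cases \<alpha>; cases \<beta>) auto
    then show ?thesis by (simp only: Z2.bit_eq_iff even_of_nat)
  qed
  then have "(\<lambda>\<beta>. of_nat (walk_length \<beta>) :: bit) ` walk_class G \<alpha>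
      = (\<lambda>_. of_nat (walk_length \<alpha>)) ` walk_class G \<alpha>"
    by (intro image_cong refl)
  also have "\<dots> = {of_nat (walk_length \<alpha>)}"
    by (rule image_constant[of \<alpha>]) (simp add: walk_class_eq)
  finally show ?thesis by (simp add: parity_functor_def)
qed

lemma is_functor_parity_functor: "is_functor (\<Pi>\<^sub>g G) Z2_groupoid parity_functor"
proof -
  interpret groupoid "\<Pi>\<^sub>g G" by (rule groupoid_fund_groupoid)
  interpret target: category Z2_groupoid by (rule category_Z2_groupoid)
  show ?thesis
  proof
    fix x assume "x \<in> Ob (\<Pi>\<^sub>g G)"
    then show "amap parity_functor (Ident (\<Pi>\<^sub>g G) x) = Ident Z2_groupoid (omap parity_functor x)"
      using amap_parity_functor[of "[x]"] by (simp add: fund_groupoid_def Z2_groupoid_def is_walk_iff)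
  next
    fix x y z g h assume "g \<in> Hom (\<Pi>\<^sub>g G) x y" "h \<in> Hom (\<Pi>\<^sub>g G) y z"
    then obtain \<alpha> \<beta> where w: "\<alpha> \<in> walks G x y" "\<beta> \<in> walks G y z"
      and e: "g = walk_class G \<alpha>" "h = walk_class G \<beta>"
      by (auto simp: fund_groupoid_def)
    have "walk_length (walk_concat \<alpha> \<beta>) = walk_length \<alpha> + walk_length \<beta>"
      using w by (cases \<alpha>; cases \<beta>) (auto simp: walks_def is_walk_iff walk_concat_def)
    then have "(of_nat (walk_length (walk_concat \<alpha> \<beta>)) :: bit)
        = of_nat (walk_length \<alpha>) + of_nat (walk_length \<beta>)"
      by (simp only: of_nat_add)
    then show "amap parity_functor (Comp (\<Pi>\<^sub>g G) g h)
        = Comp Z2_groupoid (amap parity_functor g) (amap parity_functor h)"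
      using w walk_concat_walks[OF w] fund_groupoid_Comp[OF w]
      unfolding e walks_def Z2_groupoid_def by (simp only: amap_parity_functor mem_Collect_eq cat.simps)
  qed (simp_all add: Z2_groupoid_def)
qed


lemma spider_move_walks_length:
  assumes "spider_move G \<alpha> \<beta>"
  shows "is_walk G \<alpha>" and "is_walk G \<beta>" and "last \<alpha> = last \<beta>" and "length \<alpha> = length \<beta>"
  using assms by (auto elim!: spider_move.cases)

lemma spider_equiv_length: "spider_equiv G \<alpha> \<beta> \<Longrightarrow> length \<alpha> = length \<beta>"
  by (induction rule: equivclp_induct) (auto dest: spider_move_walks_length(4))

end

section \<open>Padding walks\<close>

text \<open>The argument \<open>n\<close> is a function on vertices and not a single vertex, so
  \<open>pad n\<close> can be iterated and applied to walks with any endpoint.\<close>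

definition pad :: "('a \<Rightarrow> 'a) \<Rightarrow> 'a list \<Rightarrow> 'a list" where
  "pad n \<alpha> = \<alpha> @ [n (last \<alpha>), last \<alpha>]"

lemma length_funpow_pad: "length ((pad n ^^ k) \<alpha>) = length \<alpha> + 2 * k"
  by (induction k) (simp_all add: pad_def)

lemma pad_zip:
  assumes "length \<alpha> = length \<beta>" and "\<alpha> \<noteq> []"
  shows "pad (map_prod m n) (zip \<alpha> \<beta>) = zip (pad m \<alpha>) (pad n \<beta>)"
proof -
  have "last (zip \<alpha> \<beta>) = (last \<alpha>, last \<beta>)"
    using assms by (intro last_zip) auto
  with assms(1) show ?thesis by (simp add: pad_def)
qed

lemma funpow_pad_zip:
  assumes "length \<alpha> = length \<beta>" and "\<alpha> \<noteq> []"
  shows "(pad (map_prod m n) ^^ k) (zip \<alpha> \<beta>) = zip ((pad m ^^ k) \<alpha>) ((pad n ^^ k) \<beta>)"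
proof (induction k)
  case (Suc k)
  have "(pad m ^^ k) \<alpha> \<noteq> []"
    using assms(2) length_funpow_pad[where n = m and k = k and \<alpha> = \<alpha>] by auto
  with Suc assms(1) show ?case
    by (simp add: pad_zip length_funpow_pad)
qed simp

locale neighbour_choice = pair_sym_digraph +
  fixes n
  assumes neighbour: "v \<in> pverts G \<Longrightarrow> (v, n v) \<in> parcs G"
begin

lemma neighbour_in_verts: "v \<in> pverts G \<Longrightarrow> n v \<in> pverts G"
  using neighbour in_arcsD2 by blast

lemma pad_walks:
  assumes "\<alpha> \<in> walks G x y"
  shows "pad n \<alpha> \<in> walks G x y"
proof -
  have "last \<alpha> \<in> pverts G" using assms last_in_set by (auto simp: walks_def is_walk_iff)
  then show ?thesis
    using assms neighbour[of "last \<alpha>"] neighbour_in_verts[of "last \<alpha>"] parcs_sym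
    by (auto simp: walks_def is_walk_iff pad_def successively_append_iff successively_Cons)
qed

lemma pad_equiv:
  assumes "\<alpha> \<in> walks G x y"
  shows "walk_equiv G (pad n \<alpha>) \<alpha>"
proof -
  have "\<alpha> \<noteq> []" using assms by (simp add: walks_def is_walk_iff)
  then have \<alpha>: "\<alpha> = butlast \<alpha> @ [last \<alpha>]" by simp
  have e: "pad n \<alpha> = butlast \<alpha> @ [last \<alpha>, n (last \<alpha>), last \<alpha>] @ []"
    using \<alpha> unfolding pad_def by (metis append.assoc append_Cons append_Nil)
  have "is_walk G (pad n \<alpha>)" using pad_walks[OF assms] by (simp add: walks_def)
  then have "prune_move G (pad n \<alpha>) (butlast \<alpha> @ [last \<alpha>] @ [])"
    unfolding e by (rule prune_move.prune)
  then show ?thesis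
    using \<alpha> by (auto simp: elementary_move_def intro!: r_into_equivclp)
qed

lemma funpow_pad:
  assumes "\<alpha> \<in> walks G x y"
  shows "(pad n ^^ k) \<alpha> \<in> walks G x y" and "walk_equiv G ((pad n ^^ k) \<alpha>) \<alpha>"
proof -
  have "(pad n ^^ k) \<alpha> \<in> walks G x y \<and> walk_equiv G ((pad n ^^ k) \<alpha>) \<alpha>"
  proof (induction k)
    case (Suc k)
    then show ?case
      using pad_walks pad_equiv equivclp_trans by (metis funpow.simps(2) o_apply)
  qed (use assms in simp)
  then show "(pad n ^^ k) \<alpha> \<in> walks G x y" "walk_equiv G ((pad n ^^ k) \<alpha>) \<alpha>" by auto
qed

text \<open>The backtrack moves one vertex further by changing \<open>p a x a b q\<close> into \<open>p a b a b q\<close>.\<close>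

lemma backtrack_spider_equiv_pad:
  "is_walk G (p @ [a, x, a] @ q) \<Longrightarrow> spider_equiv G (p @ [a, x, a] @ q) (pad n (p @ [a] @ q))"
proof (induction q arbitrary: p a x)
  case Nil
  then have "is_walk G (p @ [a])"
    by (auto simp: is_walk_iff successively_append_iff)
  then have "is_walk G (pad n (p @ [a]))"
    using pad_walks[of "p @ [a]"] by (simp add: walks_def)
  \<comment> \<open>Once the backtrack has reached the end, its tip is still arbitrary; one more
    spider move exchanges it for the chosen neighbour.\<close>
  then have "spider_move G (p @ [a, x, a] @ []) (p @ [a, n a, a] @ [])"
    using Nil by (intro spider_move.spider) (simp_all add: pad_def)
  then show ?case by (auto simp: pad_def)
next
  case (Cons b q)
  have walk: "is_walk G (p @ [a, b, a, b] @ q)"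
    using Cons.prems parcs_sym[of a b]
    by (auto simp: is_walk_iff successively_append_iff successively_Cons)
  then have "spider_move G (p @ [a, x, a] @ b # q) (p @ [a, b, a] @ b # q)"
    using Cons.prems by (intro spider_move.spider) simp_all
  then have "spider_equiv G (p @ [a, x, a] @ b # q) ((p @ [a]) @ [b, a, b] @ q)"
    by auto
  also have "spider_equiv G \<dots> (pad n ((p @ [a]) @ [b] @ q))"
    by (rule Cons.IH) (use walk in simp)
  finally show ?case by simp
qed

text \<open>Both walks end in the same vertex, so both receive the same backtrack.\<close>

lemma spider_move_pad:
  assumes "spider_move G \<alpha> \<beta>"
  shows "spider_move G (pad n \<alpha>) (pad n \<beta>)"
proof -
  have w: "is_walk G (pad n \<alpha>)" "is_walk G (pad n \<beta>)"
    using pad_walks spider_move_walks_length[OF assms] by (auto simp: walks_def)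
  have last: "last \<alpha> = last \<beta>" by (rule spider_move_walks_length[OF assms])
  show ?thesis
    using assms
  proof cases
    case (spider p a x b q y)
    let ?q = "q @ [n (last \<alpha>), last \<alpha>]"
    have "pad n \<alpha> = p @ [a, x, b] @ ?q" "pad n \<beta> = p @ [a, y, b] @ ?q"
      unfolding pad_def last[symmetric] by (simp_all add: spider(1,2))
    with w show ?thesis by (metis spider_move.spider)
  qed
qed

lemma spider_equiv_funpow_pad:
  assumes "spider_equiv G \<alpha> \<beta>"
  shows "spider_equiv G ((pad n ^^ k) \<alpha>) ((pad n ^^ k) \<beta>)"
proof (induction k)
  case (Suc k)
  have "spider_equiv G (pad n ((pad n ^^ k) \<alpha>)) (pad n ((pad n ^^ k) \<beta>))"
    by (rule equivclp_map[OF Suc]) (blast intro: spider_move_pad)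
  then show ?case by simp
qed (use assms in simp)

text \<open>Each prune is paid for by one backtrack on its shorter side. Two exponents are needed
  because \<alpha> and \<beta> may differ in length.\<close>

lemma walk_equiv_imp_spider_equiv_pad:
  assumes "walk_equiv G \<alpha> \<beta>"
  shows "\<exists>k l. spider_equiv G ((pad n ^^ k) \<alpha>) ((pad n ^^ l) \<beta>)"
  using assms
proof (induction rule: equivclp_induct)
  case base
  show ?case by (intro exI[of _ 0]) simp
next
  case (step \<beta> \<gamma>)
  have move: "\<exists>k l. spider_equiv G ((pad n ^^ k) \<alpha>) ((pad n ^^ l) \<beta>)"
    if "elementary_move G \<alpha> \<beta>" for \<alpha> \<beta>
    using that
  proof (cases rule: elementary_moveE)
    case (spider p a x b q y)
    then have "spider_equiv G \<alpha> \<beta>" using spider_move.spider[OF spider(3,4)] by auto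
    then show ?thesis by (intro exI[of _ 0]) simp
  next
    case (prune p a x q)
    then have "spider_equiv G ((pad n ^^ 0) \<alpha>) ((pad n ^^ 1) \<beta>)"
      using backtrack_spider_equiv_pad[OF prune(3)] by simp
    then show ?thesis by blast
  qed
  obtain k l where 1: "spider_equiv G ((pad n ^^ k) \<alpha>) ((pad n ^^ l) \<beta>)"
    using step.IH by blast
  obtain k' l' where 2: "spider_equiv G ((pad n ^^ k') \<beta>) ((pad n ^^ l') \<gamma>)"
    using step.hyps(2) move equivclp_sym by metis
  \<comment> \<open>Pad the first relation by \<open>k'\<close> and the second by \<open>l\<close>,
    so that both contain the middle walk with \<open>k' + l\<close> backtracks.\<close>
  have "spider_equiv G ((pad n ^^ (k' + k)) \<alpha>) ((pad n ^^ (k' + l)) \<beta>)"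
    using spider_equiv_funpow_pad[OF 1, of k'] by (simp add: funpow_add)
  also have "spider_equiv G \<dots> ((pad n ^^ (l + l')) \<gamma>)"
    using spider_equiv_funpow_pad[OF 2, of l] by (simp add: funpow_add[symmetric] add.commute
        flip: o_apply[of "pad n ^^ l"])
  finally show ?case by blast
qed

end

section \<open>Products\<close>

lemma graph_hom_fst: "graph_hom (G \<times>\<^sub>g H) G fst"
  and graph_hom_snd: "graph_hom (G \<times>\<^sub>g H) H snd"
  by (auto simp: graph_hom_def graph_prod_def)

lemma pair_sym_digraph_prod:
  assumes "pair_sym_digraph G" and "pair_sym_digraph H"
  shows "pair_sym_digraph (G \<times>\<^sub>g H)"
proof -
  interpret G: pair_sym_digraph G by fact
  interpret H: pair_sym_digraph H by fact
  interpret GH: pair_wf_digraph "G \<times>\<^sub>g H"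
    by unfold_locales (auto simp: graph_prod_def dest: G.wellformed' H.wellformed')
  show ?thesis
    by unfold_locales (auto simp: graph_prod_def symmetric_def sym_def
        intro: G.parcs_sym H.parcs_sym)
qed

section \<open>Lifting spider moves to the product\<close>

lemma split_list_at:
  assumes "length \<beta> = length (p @ [a, x, b] @ q)"
  obtains p' a' x' b' q' where "\<beta> = p' @ [a', x', b'] @ q'" "length p' = length p" "length q' = length q"
proof -
  define d where "d = drop (length p) \<beta>"
  have "length d = Suc (Suc (Suc (length q)))"
    using assms by (simp add: d_def)
  then obtain a' x' b' q' where "d = a' # x' # b' # q'" "length q' = length q"
    by (auto simp: length_Suc_conv)
  moreover from this have "\<beta> = take (length p) \<beta> @ [a', x', b'] @ q'"
    using append_take_drop_id[of "length p" \<beta>] by (simp add: d_def)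
  moreover have "length (take (length p) \<beta>) = length p"
    using assms by simp
  ultimately show ?thesis
    using that by blast
qed

text \<open>The other coordinate stays fixed along the whole walk, so just one vertex of the zipped
  walk changes. Both orders of the factors are needed to move either coordinate.\<close>

lemma spider_move_zip:
  assumes "spider_move G \<alpha> \<alpha>'" and "is_walk H \<beta>" and "length \<alpha> = length \<beta>"
  shows "spider_move (G \<times>\<^sub>g H) (zip \<alpha> \<beta>) (zip \<alpha>' \<beta>)"
    and "spider_move (H \<times>\<^sub>g G) (zip \<beta> \<alpha>) (zip \<beta> \<alpha>')"
proof -
  obtain p a x b q y where \<alpha>: "\<alpha> = p @ [a, x, b] @ q" "\<alpha>' = p @ [a, y, b] @ q"
    "is_walk G \<alpha>" "is_walk G \<alpha>'"
    using assms(1) by (auto elim!: spider_move.cases)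
  obtain p' a' x' b' q' where \<beta>: "\<beta> = p' @ [a', x', b'] @ q'" "length p' = length p"
    "length q' = length q"
    using assms(3) \<alpha>(1) split_list_at by metis
  have len: "length \<alpha>' = length \<beta>" using assms(3) \<alpha> by simp
  show "spider_move (G \<times>\<^sub>g H) (zip \<alpha> \<beta>) (zip \<alpha>' \<beta>)"
    using spider_move.spider[of "G \<times>\<^sub>g H" "zip p p'" "(a, a')" "(x, x')" "(b, b')" "zip q q'" "(y, x')"]
      is_walk_zip[OF \<alpha>(3) assms(2,3)] is_walk_zip[OF \<alpha>(4) assms(2) len] \<beta>(2,3)
    unfolding \<alpha>(1,2) \<beta>(1) by simp
  show "spider_move (H \<times>\<^sub>g G) (zip \<beta> \<alpha>) (zip \<beta> \<alpha>')"
    using spider_move.spider[of "H \<times>\<^sub>g G" "zip p' p" "(a', a)" "(x', x)" "(b', b)" "zip q' q" "(x', y)"]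
      is_walk_zip[OF assms(2) \<alpha>(3) assms(3)[symmetric]] is_walk_zip[OF assms(2) \<alpha>(4) len[symmetric]]
      \<beta>(2,3)
    unfolding \<alpha>(1,2) \<beta>(1) by simp
qed

lemma spider_equiv_zip:
  assumes "pair_sym_digraph G"
    and "spider_equiv G \<alpha> \<alpha>'" and "is_walk H \<beta>" and "length \<alpha> = length \<beta>"
  shows "spider_equiv (G \<times>\<^sub>g H) (zip \<alpha> \<beta>) (zip \<alpha>' \<beta>)"
    and "spider_equiv (H \<times>\<^sub>g G) (zip \<beta> \<alpha>) (zip \<beta> \<alpha>')"
proof -
  interpret pair_sym_digraph G by fact
  have "spider_equiv (G \<times>\<^sub>g H) (zip \<alpha> \<beta>) (zip \<alpha>' \<beta>) \<and>
      spider_equiv (H \<times>\<^sub>g G) (zip \<beta> \<alpha>) (zip \<beta> \<alpha>')"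
    using assms(2)
  proof (induction rule: equivclp_induct)
    case (step \<gamma> \<delta>)
    have "length \<gamma> = length \<beta>" "length \<delta> = length \<beta>"
      using spider_equiv_length[OF step.hyps(1)] step.hyps(2) spider_move_walks_length(4) assms(4)
      by metis+
    then have "spider_move (G \<times>\<^sub>g H) (zip \<gamma> \<beta>) (zip \<delta> \<beta>) \<or> spider_move (G \<times>\<^sub>g H) (zip \<delta> \<beta>) (zip \<gamma> \<beta>)"
      "spider_move (H \<times>\<^sub>g G) (zip \<beta> \<gamma>) (zip \<beta> \<delta>) \<or> spider_move (H \<times>\<^sub>g G) (zip \<beta> \<delta>) (zip \<beta> \<gamma>)"
      using step.hyps(2) spider_move_zip assms(3) by blast+
    with step.IH show ?case
      by (blast intro: equivclp_into_equivclp)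
  qed simp
  then show "spider_equiv (G \<times>\<^sub>g H) (zip \<alpha> \<beta>) (zip \<alpha>' \<beta>)"
    "spider_equiv (H \<times>\<^sub>g G) (zip \<beta> \<alpha>) (zip \<beta> \<alpha>')" by auto
qed

section \<open>The comparison functor\<close>

locale two_neighbour_choices = G: neighbour_choice G m + H: neighbour_choice H n
  for G :: "'a pair_pre_digraph" and m and H :: "'b pair_pre_digraph" and n
begin

sublocale GH: neighbour_choice "G \<times>\<^sub>g H" "map_prod m n"
proof -
  interpret pair_sym_digraph "G \<times>\<^sub>g H"
    by (intro pair_sym_digraph_prod G.pair_sym_digraph_axioms H.pair_sym_digraph_axioms)
  show "neighbour_choice (G \<times>\<^sub>g H) (map_prod m n)"
    by unfold_locales (auto simp: graph_prod_def G.neighbour H.neighbour)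
qed

lemma project_walks:
  assumes "\<omega> \<in> walks (G \<times>\<^sub>g H) v w"
  shows "map fst \<omega> \<in> walks G (fst v) (fst w)" and "map snd \<omega> \<in> walks H (snd v) (snd w)"
proof -
  have "\<omega> \<noteq> []" using assms by (simp add: walks_def GH.is_walk_iff)
  with assms show "map fst \<omega> \<in> walks G (fst v) (fst w)" "map snd \<omega> \<in> walks H (snd v) (snd w)"
    using is_walk_map[OF graph_hom_fst[of G H], of \<omega>] is_walk_map[OF graph_hom_snd[of G H], of \<omega>]
    by (auto simp: walks_def hd_map last_map)
qed

text \<open>Pad until both projections are related by spider moves alone, then move the first
  coordinate with the second fixed, and the second with the first fixed.\<close>

lemma walk_equiv_prodI:
  assumes \<omega>: "\<omega> \<in> walks (G \<times>\<^sub>g H) v w" and \<omega>': "\<omega>' \<in> walks (G \<times>\<^sub>g H) v w"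
    and fst: "walk_equiv G (map fst \<omega>) (map fst \<omega>')"
    and snd: "walk_equiv H (map snd \<omega>) (map snd \<omega>')"
  shows "walk_equiv (G \<times>\<^sub>g H) \<omega> \<omega>'"
proof -
  obtain k k' where "spider_equiv G ((pad m ^^ k) (map fst \<omega>)) ((pad m ^^ k') (map fst \<omega>'))"
    using G.walk_equiv_imp_spider_equiv_pad[OF fst] by blast
  note pad_G = G.spider_equiv_funpow_pad[OF this] G.spider_equiv_length[OF this]
  obtain l l' where "spider_equiv H ((pad n ^^ l) (map snd \<omega>)) ((pad n ^^ l') (map snd \<omega>'))"
    using H.walk_equiv_imp_spider_equiv_pad[OF snd] by blast
  note pad_H = H.spider_equiv_funpow_pad[OF this] H.spider_equiv_length[OF this]
  \<comment> \<open>Padding \<omega> pads both projections equally often, so \<open>k\<close> and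
    \<open>l\<close> are both raised to \<open>k + l\<close>.\<close>
  have equiv_G: "spider_equiv G ((pad m ^^ (l + k)) (map fst \<omega>)) ((pad m ^^ (l + k')) (map fst \<omega>'))"
    using pad_G(1)[of l] by (simp add: funpow_add)
  have equiv_H: "spider_equiv H ((pad n ^^ (k + l)) (map snd \<omega>)) ((pad n ^^ (k + l')) (map snd \<omega>'))"
    using pad_H(1)[of k] by (simp add: funpow_add)
  \<comment> \<open>Both projections of \<omega> are as long as \<omega>, and likewise for
    \<omega>'. Spider moves keep the length, so \<open>k - k'\<close> and \<open>l - l'\<close>, as
    integers, are both half the difference of these lengths. Hence the projections of \<omega>' are
    padded equally often too.\<close>
  have eq: "l + k' = k + l'"
    using pad_G(2) pad_H(2) by (simp add: length_funpow_pad)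
  let ?\<omega> = "(pad (map_prod m n) ^^ (k + l)) \<omega>"
  let ?\<omega>' = "(pad (map_prod m n) ^^ (k + l')) \<omega>'"
  have ne: "\<omega> \<noteq> []" "\<omega>' \<noteq> []"
    using \<omega> \<omega>' by (auto simp: walks_def GH.is_walk_iff)
  note walk = project_walks(1)[OF \<omega>'] project_walks(2)[OF \<omega>]
  have "walk_equiv (G \<times>\<^sub>g H) \<omega> ?\<omega>"
    using GH.funpow_pad(2)[OF \<omega>] by (rule equivclp_sym)
  also have "?\<omega> = zip ((pad m ^^ (k + l)) (map fst \<omega>)) ((pad n ^^ (k + l)) (map snd \<omega>))"
    using funpow_pad_zip[of "map fst \<omega>" "map snd \<omega>", where m = m and n = n and k = "k + l"] ne by (simp add: zip_map_fst_snd)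
  also have "walk_equiv (G \<times>\<^sub>g H) \<dots>
      (zip ((pad m ^^ (l + k')) (map fst \<omega>')) ((pad n ^^ (k + l)) (map snd \<omega>)))"
    using spider_equiv_zip(1)[OF G.pair_sym_digraph_axioms equiv_G, of H "(pad n ^^ (k + l)) (map snd \<omega>)"]
      H.funpow_pad(1)[OF walk(2), of "k + l"]
    by (intro spider_equiv_imp_walk_equiv) (simp add: walks_def length_funpow_pad add.commute)
  also have "walk_equiv (G \<times>\<^sub>g H) \<dots>
      (zip ((pad m ^^ (k + l')) (map fst \<omega>')) ((pad n ^^ (k + l')) (map snd \<omega>')))"
    using spider_equiv_zip(2)[OF H.pair_sym_digraph_axioms equiv_H, of G "(pad m ^^ (k + l')) (map fst \<omega>')"]
      G.funpow_pad(1)[OF walk(1), of "k + l'"] H.spider_equiv_length[OF equiv_H]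
    unfolding eq by (intro spider_equiv_imp_walk_equiv) (simp add: walks_def length_funpow_pad)
  also have "\<dots> = ?\<omega>'"
    using funpow_pad_zip[of "map fst \<omega>'" "map snd \<omega>'", where m = m and n = n and k = "k + l'"] ne by (simp add: zip_map_fst_snd)
  also have "walk_equiv (G \<times>\<^sub>g H) ?\<omega>' \<omega>'"
    by (rule GH.funpow_pad(2)[OF \<omega>'])
  finally show ?thesis .
qed

lemma walk_lift:
  assumes \<alpha>: "\<alpha> \<in> walks G x x'" and \<beta>: "\<beta> \<in> walks H y y'"
    and "even (length \<alpha>) \<longleftrightarrow> even (length \<beta>)"
  obtains \<omega> where "\<omega> \<in> walks (G \<times>\<^sub>g H) (x, y) (x', y')"
    "walk_equiv G (map fst \<omega>) \<alpha>" "walk_equiv H (map snd \<omega>) \<beta>"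
proof -
  \<comment> \<open>With these values both padded walks have
    \<open>2 * length \<alpha> + length \<beta>\<close> entries, without deciding which walk is
    longer. Equal parity makes the division exact.\<close>
  define k l where "k = (length \<alpha> + length \<beta>) div 2" and "l = length \<alpha>"
  have "2 * k = length \<alpha> + length \<beta>"
    using assms(3) by (simp add: k_def)
  then have len: "length \<alpha> + 2 * k = length \<beta> + 2 * l"
    by (simp add: l_def)
  define \<alpha>' where "\<alpha>' = (pad m ^^ k) \<alpha>"
  define \<beta>' where "\<beta>' = (pad n ^^ l) \<beta>"
  have w: "\<alpha>' \<in> walks G x x'" "\<beta>' \<in> walks H y y'"
    using G.funpow_pad(1)[OF \<alpha>] H.funpow_pad(1)[OF \<beta>] by (simp_all add: \<alpha>'_def \<beta>'_def)
  have len': "length \<alpha>' = length \<beta>'"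
    using len by (simp add: \<alpha>'_def \<beta>'_def length_funpow_pad)
  have ne: "\<alpha>' \<noteq> []" "\<beta>' \<noteq> []"
    using w by (auto simp: walks_def G.is_walk_iff H.is_walk_iff)
  have "zip \<alpha>' \<beta>' \<in> walks (G \<times>\<^sub>g H) (x, y) (x', y')"
    using w is_walk_zip len' ne by (auto simp: walks_def hd_zip last_zip)
  moreover have "walk_equiv G (map fst (zip \<alpha>' \<beta>')) \<alpha>" "walk_equiv H (map snd (zip \<alpha>' \<beta>')) \<beta>"
    using len' G.funpow_pad(2)[OF \<alpha>] H.funpow_pad(2)[OF \<beta>] by (simp_all add: \<alpha>'_def \<beta>'_def)
  ultimately show ?thesis by (rule that)
qed

lemma amap_product_comparison:
  "amap (product_comparison G H) (walk_class (G \<times>\<^sub>g H) \<omega>)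
    = (walk_class G (map fst \<omega>), walk_class H (map snd \<omega>))"
  using GH.amap_induced_functor[OF graph_hom_fst G.pair_sym_digraph_axioms, of \<omega>]
    GH.amap_induced_functor[OF graph_hom_snd H.pair_sym_digraph_axioms, of \<omega>]
  by (simp add: product_comparison_def)

lemma groupoid_parity_pullback: "groupoid (parity_pullback G H)"
  unfolding parity_pullback_def
  by (intro pullback_groupoid[where E = Z2_groupoid] G.groupoid_fund_groupoid
      H.groupoid_fund_groupoid G.is_functor_parity_functor H.is_functor_parity_functor)

lemma parity_pullback_Ob: "Ob (parity_pullback G H) = pverts G \<times> pverts H"
  by (auto simp: parity_pullback_def pullback_def fund_groupoid_def parity_functor_def)

lemma is_functor_product_comparison:
  "is_functor (\<Pi>\<^sub>g (G \<times>\<^sub>g H)) (parity_pullback G H) (product_comparison G H)"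
proof -
  interpret P: is_functor "\<Pi>\<^sub>g (G \<times>\<^sub>g H)" "\<Pi>\<^sub>g G" "induced_functor G fst"
    by (rule GH.is_functor_induced_functor[OF graph_hom_fst G.pair_sym_digraph_axioms])
  interpret Q: is_functor "\<Pi>\<^sub>g (G \<times>\<^sub>g H)" "\<Pi>\<^sub>g H" "induced_functor H snd"
    by (rule GH.is_functor_induced_functor[OF graph_hom_snd H.pair_sym_digraph_axioms])
  interpret target: groupoid "parity_pullback G H" by (rule groupoid_parity_pullback)
  have omap: "omap (induced_functor G fst) v = fst v" "omap (induced_functor H snd) v = snd v" for v
    by (simp_all add: induced_functor_def)
  show ?thesis
  proof
    fix v assume "v \<in> Ob (\<Pi>\<^sub>g (G \<times>\<^sub>g H))"
    then show "omap (product_comparison G H) v \<in> Ob (parity_pullback G H)"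
      by (simp add: parity_pullback_Ob product_comparison_def fund_groupoid_def graph_prod_def)
    show "amap (product_comparison G H) (Ident (\<Pi>\<^sub>g (G \<times>\<^sub>g H)) v)
        = Ident (parity_pullback G H) (omap (product_comparison G H) v)"
      using \<open>v \<in> _\<close> P.amap_Ident Q.amap_Ident
      by (simp add: parity_pullback_def pullback_def product_comparison_def omap split: prod.split)
  next
    fix v w f assume "f \<in> Hom (\<Pi>\<^sub>g (G \<times>\<^sub>g H)) v w"
    then obtain \<omega> where \<omega>: "\<omega> \<in> walks (G \<times>\<^sub>g H) v w" "f = walk_class (G \<times>\<^sub>g H) \<omega>"
      by (auto simp: fund_groupoid_def)
    \<comment> \<open>Both projections have the length of \<omega>, hence the same parity.\<close>
    have "amap parity_functor (walk_class G (map fst \<omega>))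
        = amap parity_functor (walk_class H (map snd \<omega>))"
      using project_walks[OF \<omega>(1)] G.amap_parity_functor[of "map fst \<omega>"]
        H.amap_parity_functor[of "map snd \<omega>"] by (simp add: walks_def)
    then show "amap (product_comparison G H) f \<in> Hom (parity_pullback G H)
        (omap (product_comparison G H) v) (omap (product_comparison G H) w)"
      using project_walks[OF \<omega>(1)] unfolding \<omega>(2) amap_product_comparison
      by (cases v, cases w)
        (simp add: product_comparison_def parity_pullback_def pullback_def fund_groupoid_def)
  next
    fix u v w f g
    assume "u \<in> Ob (\<Pi>\<^sub>g (G \<times>\<^sub>g H))" "v \<in> Ob (\<Pi>\<^sub>g (G \<times>\<^sub>g H))" "w \<in> Ob (\<Pi>\<^sub>g (G \<times>\<^sub>g H))"
      "f \<in> Hom (\<Pi>\<^sub>g (G \<times>\<^sub>g H)) u v" "g \<in> Hom (\<Pi>\<^sub>g (G \<times>\<^sub>g H)) v w"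
    then show "amap (product_comparison G H) (Comp (\<Pi>\<^sub>g (G \<times>\<^sub>g H)) f g)
        = Comp (parity_pullback G H) (amap (product_comparison G H) f) (amap (product_comparison G H) g)"
      using P.amap_Comp[of u v w f g] Q.amap_Comp[of u v w f g]
      by (simp add: parity_pullback_def pullback_def product_comparison_def)
  qed
qed

text \<open>Injectivity is \<open>walk_equiv_prodI\<close> and surjectivity is
  \<open>walk_lift\<close>, both read on classes.\<close>

lemma bij_betw_amap_product_comparison:
  "bij_betw (amap (product_comparison G H)) (Hom (\<Pi>\<^sub>g (G \<times>\<^sub>g H)) v w) (Hom (parity_pullback G H) v w)"
proof (rule bij_betw_imageI)
  show "inj_on (amap (product_comparison G H)) (Hom (\<Pi>\<^sub>g (G \<times>\<^sub>g H)) v w)"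
  proof (rule inj_onI)
    fix f g
    assume "f \<in> Hom (\<Pi>\<^sub>g (G \<times>\<^sub>g H)) v w" "g \<in> Hom (\<Pi>\<^sub>g (G \<times>\<^sub>g H)) v w"
      and eq: "amap (product_comparison G H) f = amap (product_comparison G H) g"
    then obtain \<omega> \<omega>' where \<omega>: "\<omega> \<in> walks (G \<times>\<^sub>g H) v w" "\<omega>' \<in> walks (G \<times>\<^sub>g H) v w"
      and e: "f = walk_class (G \<times>\<^sub>g H) \<omega>" "g = walk_class (G \<times>\<^sub>g H) \<omega>'"
      by (auto simp: fund_groupoid_def)
    show "f = g"
      using eq walk_equiv_prodI[OF \<omega>]
      by (simp add: e amap_product_comparison G.walk_class_eq_iff H.walk_class_eq_iff
          GH.walk_class_eq_iff)
  qed
  have "f \<in> amap (product_comparison G H) ` Hom (\<Pi>\<^sub>g (G \<times>\<^sub>g H)) v w"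
    if arrow: "f \<in> Hom (parity_pullback G H) v w" for f
  proof -
    obtain x y x' y' where v: "v = (x, y)" and w: "w = (x', y')" by (cases v, cases w)
    obtain \<alpha> \<beta> where \<alpha>: "\<alpha> \<in> walks G x x'" and \<beta>: "\<beta> \<in> walks H y y'"
      and f: "f = (walk_class G \<alpha>, walk_class H \<beta>)"
      and parity: "amap parity_functor (walk_class G \<alpha>) = amap parity_functor (walk_class H \<beta>)"
      using arrow by (auto simp: v w parity_pullback_def pullback_def fund_groupoid_def)
    have ne: "\<alpha> \<noteq> []" "\<beta> \<noteq> []"
      using \<alpha> \<beta> by (auto simp: walks_def G.is_walk_iff H.is_walk_iff)
    have "(of_nat (walk_length \<alpha>) :: bit) = of_nat (walk_length \<beta>)"
      using parity G.amap_parity_functor[of \<alpha>] H.amap_parity_functor[of \<beta>] \<alpha> \<beta>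
      by (simp add: walks_def)
    then have "even (walk_length \<alpha>) \<longleftrightarrow> even (walk_length \<beta>)"
      by (simp only: Z2.bit_eq_iff even_of_nat)
    with ne have "even (length \<alpha>) \<longleftrightarrow> even (length \<beta>)"
      by (cases \<alpha>; cases \<beta>) auto
    then obtain \<omega> where "\<omega> \<in> walks (G \<times>\<^sub>g H) v w"
      "walk_equiv G (map fst \<omega>) \<alpha>" "walk_equiv H (map snd \<omega>) \<beta>"
      using walk_lift[OF \<alpha> \<beta>] unfolding v w by blast
    then show ?thesis
      using amap_product_comparison[of \<omega>]
      by (intro image_eqI[of _ _ "walk_class (G \<times>\<^sub>g H) \<omega>"])
        (simp_all add: f G.walk_class_eq_iff H.walk_class_eq_iff fund_groupoid_def
          equivclp_sym)
  qed
  moreover have "amap (product_comparison G H) f \<in> Hom (parity_pullback G H) v w"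
    if f: "f \<in> Hom (\<Pi>\<^sub>g (G \<times>\<^sub>g H)) v w" for f
  proof -
    interpret is_functor "\<Pi>\<^sub>g (G \<times>\<^sub>g H)" "parity_pullback G H" "product_comparison G H"
      by (rule is_functor_product_comparison)
    obtain \<omega> where \<omega>: "\<omega> \<in> walks (G \<times>\<^sub>g H) v w" using f by (auto simp: fund_groupoid_def)
    \<comment> \<open>Nothing is assumed about \<open>v\<close> and \<open>w\<close>; they are
      vertices because they are the ends of a walk.\<close>
    then have "v \<in> Ob (\<Pi>\<^sub>g (G \<times>\<^sub>g H))" "w \<in> Ob (\<Pi>\<^sub>g (G \<times>\<^sub>g H))"
      using hd_in_set[of \<omega>] last_in_set[of \<omega>]
      by (auto simp: fund_groupoid_def walks_def GH.is_walk_iff)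
    with f show ?thesis
      using amap_in_Hom by (simp add: product_comparison_def)
  qed
  ultimately show "amap (product_comparison G H) ` Hom (\<Pi>\<^sub>g (G \<times>\<^sub>g H)) v w
      = Hom (parity_pullback G H) v w"
    by blast
qed

lemma groupoid_isomorphism_product_comparison:
  "groupoid_isomorphism (\<Pi>\<^sub>g (G \<times>\<^sub>g H)) (parity_pullback G H) (product_comparison G H)"
proof (rule groupoid_isomorphism_if_bij)
  have omap: "omap (product_comparison G H) = (\<lambda>v. v)"
    by (simp add: product_comparison_def)
  show "bij_betw (omap (product_comparison G H)) (Ob (\<Pi>\<^sub>g (G \<times>\<^sub>g H))) (Ob (parity_pullback G H))"
    unfolding omap parity_pullback_Ob by (auto simp: bij_betw_def fund_groupoid_def graph_prod_def)
  show "bij_betw (amap (product_comparison G H)) (Hom (\<Pi>\<^sub>g (G \<times>\<^sub>g H)) v w)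
      (Hom (parity_pullback G H) (omap (product_comparison G H) v) (omap (product_comparison G H) w))"
    for v w
    unfolding omap by (rule bij_betw_amap_product_comparison)
qed (rule GH.groupoid_fund_groupoid groupoid_parity_pullback is_functor_product_comparison)+

end

lemma no_isolated_vertices_imp_neighbour_choice:
  assumes "pair_sym_digraph G" and "no_isolated_vertices G"
  obtains n where "neighbour_choice G n"
proof -
  obtain n where "\<forall>v \<in> pverts G. (v, n v) \<in> parcs G"
    using assms(2) unfolding no_isolated_vertices_def by metis
  with assms(1) have "neighbour_choice G n"
    by (simp add: neighbour_choice_def neighbour_choice_axioms_def)
  then show ?thesis by (rule that)
qed

theorem theorem5p1:
  fixes G :: "'a pair_pre_digraph" and H :: "'b pair_pre_digraph"
  assumes "pair_sym_digraph G" and "pair_sym_digraph H"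
    and "no_isolated_vertices G" and "no_isolated_vertices H"
  shows "groupoid_isomorphism (\<Pi>\<^sub>g (G \<times>\<^sub>g H)) (parity_pullback G H) (product_comparison G H)"
proof -
  obtain m where m: "neighbour_choice G m"
    using no_isolated_vertices_imp_neighbour_choice assms(1,3) .
  obtain n where n: "neighbour_choice H n"
    using no_isolated_vertices_imp_neighbour_choice assms(2,4) .
  interpret two_neighbour_choices G m H n
    using m n by (simp add: two_neighbour_choices_def)
  show ?thesis
    by (rule groupoid_isomorphism_product_comparison)
qed

end
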